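(* Let $\mu$ be a Radon measure on $\mathbb{R}^d$, let $1\le p,q\le\infty$ and let $p',q'$ denote the corresponding Hölder conjugates. Let $v$ be a Borel vector field on $\mathbb{R}^d$ with $v\in L^p(\mu)$, and let $T_v:C^1_c(\mathbb{R}^d)\to L^p(\mu)$ be the directional derivative operator $T_vu:=\frac{\partial u}{\partial v}$ (that is, $T_vu(x)$ is the derivative of $u$ at $x$ in the direction $v(x)$). Assume that there exists a Borel function $\alpha$ on $\mathbb{R}^d$ such that - $\alpha\neq0$ $\mu$-a.e.; - $\alpha\in L^{p'}(\mu)$ and $\alpha v\in L^{q'}(\mu)$; - $N:=\alpha v\mu$ is a normal $1$-current. Then $T_v$ is closable from $L^q(\mu)$ to $L^p(\mu)$.
   Context: $C^1_c(\mathbb{R}^d)$ is the space of compactly supported real functions of class $C^1$. $L^p(\mu)$ and $L^q(\mu)$ carry the strong (norm) topology. Closability is intended in the sequential sense: let $\Gamma$ be the (sequential) closure in $L^q(\mu)\times L^p(\mu)$ of the graph $\{(u,T_vu):u\in C^1_c(\mathbb{R}^d)\}$. $T_v$ is closable from $L^q(\mu)$ to $L^p(\mu)$ if for every $x\in L^q(\mu)$ there is at most one $y\in L^p(\mu)$ with $(x,y)\in\Gamma$. Currents: a $1$-current in $\mathbb{R}^d$ is a continuous linear functional on smooth compactly supported $1$-forms on $\mathbb{R}^d$; its boundary is $\langle\partial N;\varphi\rangle:=\langle N;d\varphi\rangle$; its mass is the supremum of $\langle N;\omega\rangle$ over forms with $|\omega|\le1$ everywhere; $N$ is normal if both $N$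 and $\partial N$ have finite mass. For a vector field $\tau\in L^1(\mu)$, $\tau\mu$ denotes the $1$-current $\langle\tau\mu;\omega\rangle=\int_{\mathbb{R}^d}\langle\tau(x);\omega(x)\rangle\,d\mu(x)$. *)

theory Defs
  imports "HOL-Analysis.Analysis" "HOL-Probability.Essential_Supremum"
begin

section \<open>Differentiable functions with compact support\<close>

primrec C_k :: "nat \<Rightarrow> ('a::euclidean_space \<Rightarrow> 'b::real_normed_vector) \<Rightarrow> bool" where
  "C_k 0 f \<longleftrightarrow> continuous_on UNIV f"
| "C_k (Suc k) f \<longleftrightarrow> (\<forall>x. f differentiable (at x)) \<and>
     (\<forall>h. C_k k (\<lambda>x. frechet_derivative f (at x) h))"

definition compactly_supported :: "('a::euclidean_space \<Rightarrow> 'b::real_normed_vector) \<Rightarrow> bool" where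
  "compactly_supported f \<longleftrightarrow> compact (closure {x. f x \<noteq> 0})"

definition C1_c :: "('a::euclidean_space \<Rightarrow> real) set" where
  "C1_c = {u. C_k 1 u \<and> compactly_supported u}"

definition directional_derivative ::
    "('a::euclidean_space \<Rightarrow> 'a) \<Rightarrow> ('a \<Rightarrow> real) \<Rightarrow> 'a \<Rightarrow> real" where
  "directional_derivative v u = (\<lambda>x. frechet_derivative u (at x) (v x))"


section \<open>Measures and Lebesgue spaces\<close>

text \<open>On a Euclidean space the last condition follows from the first two.\<close>

definition radon_measure :: "'a::euclidean_space measure \<Rightarrow> bool" where
  "radon_measure \<mu> \<longleftrightarrow> sets \<mu> = sets borel \<and>
     (\<forall>K. compact K \<longrightarrow> emeasure \<mu> K < \<infinity>) \<and>
     (\<forall>B\<in>sets borel. emeasure \<mu> B = (SUP K\<in>{K. compact K \<and> K \<subseteq> B}. emeasure \<mu> K))"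

text \<open>For \<open>p < \<infinity>\<close> this is \<open>(\<integral> \<bar>f\<bar>\<^sup>p d\<mu>)\<^sup>1\<^sup>/\<^sup>p\<close>, with value \<open>\<infinity>\<close> if the integral diverges.
  It is the usual norm for \<open>1 \<le> p\<close>.\<close>

definition Lp_norm :: "ennreal \<Rightarrow> 'a measure \<Rightarrow> ('a \<Rightarrow> 'b::real_normed_vector) \<Rightarrow> ennreal" where
  "Lp_norm p \<mu> f =
     (if p = \<infinity> then esssup \<mu> (\<lambda>x. ennreal (norm (f x)))
      else let I = (\<integral>\<^sup>+ x. ennreal (norm (f x) powr enn2real p) \<partial>\<mu>) in
        if I = \<infinity> then \<infinity> else ennreal (enn2real I powr (1 / enn2real p)))"

text \<open>Elements of \<open>Lp_space\<close> are representatives: no quotient by equality almost everywhere is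
  taken, so equality in the Lebesgue space is equality almost everywhere.\<close>

definition Lp_space :: "ennreal \<Rightarrow> 'a measure \<Rightarrow> ('a \<Rightarrow> 'b::real_normed_vector) set" where
  "Lp_space p \<mu> = {f \<in> borel_measurable \<mu>. Lp_norm p \<mu> f < \<infinity>}"


section \<open>Closability\<close>

definition graph_closure ::
    "ennreal \<Rightarrow> ennreal \<Rightarrow> 'a measure \<Rightarrow> ('a \<Rightarrow> real) set \<Rightarrow> (('a \<Rightarrow> real) \<Rightarrow> ('a \<Rightarrow> real))
      \<Rightarrow> (('a \<Rightarrow> real) \<times> ('a \<Rightarrow> real)) set" where
  "graph_closure q p \<mu> D T = {(f, g). f \<in> Lp_space q \<mu> \<and> g \<in> Lp_space p \<mu> \<and>
     (\<exists>u :: nat \<Rightarrow> 'a \<Rightarrow> real. (\<forall>n. u n \<in> D) \<and>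
        (\<lambda>n. Lp_norm q \<mu> (\<lambda>x. u n x - f x)) \<longlonglongrightarrow> 0 \<and>
        (\<lambda>n. Lp_norm p \<mu> (\<lambda>x. T (u n) x - g x)) \<longlonglongrightarrow> 0)}"

text \<open>\<open>closable q p \<mu> D T\<close>: the operator \<open>T\<close> with domain \<open>D\<close> is closable from \<open>L\<^sup>q(\<mu>)\<close> to \<open>L\<^sup>p(\<mu>)\<close>.
  The set \<open>graph_closure\<close> is invariant under changes of representatives, hence it is enough to
  compare pairs with the same representative \<open>f\<close>.\<close>

definition closable ::
    "ennreal \<Rightarrow> ennreal \<Rightarrow> 'a measure \<Rightarrow> ('a \<Rightarrow> real) set \<Rightarrow> (('a \<Rightarrow> real) \<Rightarrow> ('a \<Rightarrow> real)) \<Rightarrow> bool" where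
  "closable q p \<mu> D T \<longleftrightarrow> (\<forall>f\<in>Lp_space q \<mu>. \<forall>g\<in>Lp_space p \<mu>. \<forall>h\<in>Lp_space p \<mu>.
     (f, g) \<in> graph_closure q p \<mu> D T \<longrightarrow> (f, h) \<in> graph_closure q p \<mu> D T \<longrightarrow>
     (AE x in \<mu>. g x = h x))"


section \<open>Currents\<close>

text \<open>The value type is \<open>real\<close> for 0-forms and \<open>'a \<Rightarrow>\<^sub>L real\<close> for 1-forms. The norm of the
  latter is the dual of the Euclidean norm.\<close>

definition test_forms :: "('a::euclidean_space \<Rightarrow> 'b::real_normed_vector) set" where
  "test_forms = {\<omega>. (\<forall>k. C_k k \<omega>) \<and> compactly_supported \<omega>}"

text \<open>\<open>iterated_derivative [h\<^sub>1, \<dots>, h\<^sub>m] f\<close> is the iterated derivative of \<open>f\<close> in the constant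
  directions \<open>h\<^sub>1, \<dots>, h\<^sub>m\<close>.\<close>

primrec iterated_derivative ::
    "'a::euclidean_space list \<Rightarrow> ('a \<Rightarrow> 'b::real_normed_vector) \<Rightarrow> 'a \<Rightarrow> 'b" where
  "iterated_derivative [] f = f"
| "iterated_derivative (h # hs) f =
     iterated_derivative hs (\<lambda>x. frechet_derivative f (at x) h)"

text \<open>Convergence of test forms: supports in a common compact set, and uniform convergence of
  all derivatives. A linear functional is continuous for the usual (inductive limit) topology
  iff it is sequentially continuous for this convergence.\<close>

definition test_form_convergence ::
    "(nat \<Rightarrow> 'a::euclidean_space \<Rightarrow> 'b::real_normed_vector) \<Rightarrow> ('a \<Rightarrow> 'b) \<Rightarrow> bool" where
  "test_form_convergence W \<omega> \<longleftrightarrow>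
     (\<exists>K. compact K \<and> (\<forall>n. \<forall>x. x \<notin> K \<longrightarrow> W n x = 0)) \<and>
     (\<forall>hs. uniform_limit UNIV (\<lambda>n. iterated_derivative hs (W n))
             (iterated_derivative hs \<omega>) sequentially)"

text \<open>A current is a total function of which only the values on \<open>test_forms\<close> matter.\<close>

definition current :: "(('a::euclidean_space \<Rightarrow> 'b::real_normed_vector) \<Rightarrow> real) \<Rightarrow> bool" where
  "current N \<longleftrightarrow>
     (\<forall>\<omega>\<in>test_forms. \<forall>\<eta>\<in>test_forms. N (\<lambda>x. \<omega> x + \<eta> x) = N \<omega> + N \<eta>) \<and>
     (\<forall>\<omega>\<in>test_forms. \<forall>c. N (\<lambda>x. c *\<^sub>R \<omega> x) = c * N \<omega>) \<and>
     (\<forall>W. \<forall>\<omega>\<in>test_forms. (\<forall>n. W n \<in> test_forms) \<longrightarrow> test_form_convergence W \<omega> \<longrightarrow>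
        (\<lambda>n. N (W n)) \<longlonglongrightarrow> N \<omega>)"

definition mass :: "(('a::euclidean_space \<Rightarrow> 'b::real_normed_vector) \<Rightarrow> real) \<Rightarrow> ereal" where
  "mass N = (SUP \<omega>\<in>{\<omega> \<in> test_forms. \<forall>x. norm (\<omega> x) \<le> 1}. ereal (N \<omega>))"

definition differential :: "('a::euclidean_space \<Rightarrow> real) \<Rightarrow> 'a \<Rightarrow> ('a \<Rightarrow>\<^sub>L real)" where
  "differential \<phi> = (\<lambda>x. Blinfun (frechet_derivative \<phi> (at x)))"

definition boundary ::
    "(('a::euclidean_space \<Rightarrow> ('a \<Rightarrow>\<^sub>L real)) \<Rightarrow> real) \<Rightarrow> ('a \<Rightarrow> real) \<Rightarrow> real" where
  "boundary N = (\<lambda>\<phi>. N (differential \<phi>))"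

definition normal_1_current ::
    "(('a::euclidean_space \<Rightarrow> ('a \<Rightarrow>\<^sub>L real)) \<Rightarrow> real) \<Rightarrow> bool" where
  "normal_1_current N \<longleftrightarrow> current N \<and> mass N < \<infinity> \<and> mass (boundary N) < \<infinity>"

definition vector_measure_current ::
    "('a::euclidean_space \<Rightarrow> 'a) \<Rightarrow> 'a measure \<Rightarrow> ('a \<Rightarrow> ('a \<Rightarrow>\<^sub>L real)) \<Rightarrow> real" where
  "vector_measure_current \<tau> \<mu> = (\<lambda>\<omega>. \<integral>x. blinfun_apply (\<omega> x) (\<tau> x) \<partial>\<mu>)"

end

theory Submission
  imports Defs
begin

text \<open>By Hoelder's inequality everything reduces to convergence in \<open>L\<^sup>1(\<mu>)\<close>: if two sequences
  realise the pairs \<open>(f, g)\<close> and \<open>(f, h)\<close>, their differences \<open>d\<^sub>n\<close> satisfy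
  \<open>d\<^sub>n \<bar>\<tau>\<bar> \<longlonglongrightarrow> 0\<close> and \<open>\<partial>d\<^sub>n/\<partial>\<tau> \<longlonglongrightarrow> z = \<alpha> (g - h)\<close> in \<open>L\<^sup>1(\<mu>)\<close>, where
  \<open>\<tau> = \<alpha> v\<close>. The boundary of \<open>\<tau>\<mu>\<close> is a finite measure which may be singular with respect to \<open>\<mu>\<close>,
  so \<open>\<partial>N(\<phi> d\<^sub>n)\<close> need not tend to \<open>0\<close>. Replacing \<open>d\<^sub>n\<close> by \<open>\<epsilon> sin (d\<^sub>n/\<epsilon>)\<close> cures this:
  the boundary term is at most \<open>\<epsilon> sup \<bar>\<phi>\<bar>\<close> times the mass of \<open>\<partial>N\<close>, while the derivative picks up the factor
  \<open>cos (d\<^sub>n/\<epsilon>) \<longlonglongrightarrow> 1\<close>. In the limit \<open>\<integral> \<phi> z d\<mu>\<close> is bounded by a multiple of \<open>\<epsilon>\<close>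
  for every \<open>\<epsilon> > 0\<close>, hence \<open>z = 0\<close>.\<close>

section \<open>Smooth functions and bump functions\<close>

text \<open>\<open>C_k\<close> speaks of \<open>frechet_derivative\<close>, a choice of derivative;
  since derivatives at a point are unique, any explicit formula \<open>f'\<close> may stand in for
  it. The inductions on \<open>k\<close> below rest on this.\<close>

lemma C_k_SucI:
  assumes "\<And>x. (f has_derivative f' x) (at x)" "\<And>h. C_k k (\<lambda>x. f' x h)"
  shows "C_k (Suc k) f"
proof -
  have "frechet_derivative f (at x) = f' x" for x
    using frechet_derivative_at[OF assms(1)] by simp
  then show ?thesis
    using assms by (auto simp: differentiable_def)
qed

lemma C_k_Suc_has_derivative:
  assumes "C_k (Suc k) f"
  shows "(f has_derivative frechet_derivative f (at x)) (at x)"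
  using assms frechet_derivative_works by auto

lemma C_k_Suc_lower: "C_k (Suc k) f \<Longrightarrow> C_k k f"
proof (induction k arbitrary: f)
  case 0
  then show ?case
    by (auto simp: continuous_on_eq_continuous_at intro: differentiable_imp_continuous_within)
next
  case (Suc k)
  then show ?case by (metis C_k.simps(2))
qed

lemma C_k_antimono: "C_k k f \<Longrightarrow> l \<le> k \<Longrightarrow> C_k l f"
  by (induction k) (auto simp: le_Suc_eq simp del: C_k.simps dest: C_k_Suc_lower)

lemma C_k_imp_continuous: "C_k k f \<Longrightarrow> continuous_on UNIV f"
  using C_k_antimono[of k f 0] by simp

lemma C_k_const: "C_k k (\<lambda>x. c)"
proof (induction k arbitrary: c)
  case (Suc k)
  show ?case
    by (rule C_k_SucI[where f'="\<lambda>x h. 0"]) (auto intro: Suc)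
qed auto

lemma C_k_add: "C_k k f \<Longrightarrow> C_k k g \<Longrightarrow> C_k k (\<lambda>x. f x + g x)"
proof (induction k arbitrary: f g)
  case (Suc k)
  show ?case
    by (rule C_k_SucI[OF has_derivative_add[OF C_k_Suc_has_derivative[OF Suc.prems(1)] C_k_Suc_has_derivative[OF Suc.prems(2)]]])
      (use Suc in auto)
qed (auto intro: continuous_intros)

lemma C_k_mult:
  fixes f g :: "'a::euclidean_space \<Rightarrow> real"
  shows "C_k k f \<Longrightarrow> C_k k g \<Longrightarrow> C_k k (\<lambda>x. f x * g x)"
proof (induction k arbitrary: f g)
  case (Suc k)
  show ?case
    by (rule C_k_SucI[OF has_derivative_mult[OF C_k_Suc_has_derivative[OF Suc.prems(1)] C_k_Suc_has_derivative[OF Suc.prems(2)]]])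
      (intro C_k_add Suc.IH; use Suc.prems C_k_Suc_lower in auto)
qed (auto intro: continuous_intros)

lemma C_k_prod:
  fixes f :: "'i \<Rightarrow> 'a::euclidean_space \<Rightarrow> real"
  assumes "\<And>i. i \<in> I \<Longrightarrow> C_k k (f i)"
  shows "C_k k (\<lambda>x. \<Prod>i\<in>I. f i x)"
  using assms
  by (induction I rule: infinite_finite_induct) (auto intro: C_k_const C_k_mult)

lemma C_k_inner_left: "C_k k (\<lambda>x. x \<bullet> i)"
proof (cases k)
  case (Suc l)
  show ?thesis unfolding Suc
    by (rule C_k_SucI[where f'="\<lambda>x h. h \<bullet> i"]) (auto intro!: derivative_eq_intros C_k_const)
qed (auto intro: continuous_intros)

text \<open>For \<open>P = 1\<close> this is the classical function that is flat at \<open>0\<close>; the polynomial factor makes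
  the family closed under differentiation.\<close>

definition flat :: "real poly \<Rightarrow> real \<Rightarrow> real" where
  "flat P t = (if t \<le> 0 then 0 else poly P (1 / t) * exp (- (1 / t)))"

lemma tendsto_poly_times_exp_minus:
  fixes P :: "real poly"
  shows "((\<lambda>s. poly P s * exp (- s)) \<longlongrightarrow> 0) at_top"
proof -
  have "((\<lambda>s. \<Sum>i\<le>degree P. coeff P i * (s ^ i / exp s)) \<longlongrightarrow> (\<Sum>i\<le>degree P. coeff P i * 0)) at_top"
    by (intro tendsto_sum tendsto_mult tendsto_const tendsto_power_div_exp_0)
  then show ?thesis
    by (simp add: poly_altdef exp_minus divide_inverse sum_distrib_right mult.assoc)
qed

text \<open>For t > 0 the derivative of P(1/t) exp(-1/t) is (P - P')(1/t) exp(-1/t) / t^2, and the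
  factor 1/t^2 is the polynomial X^2 = \<open>[:0, 0, 1:]\<close> at 1/t. At 0 the exponential beats
  every power of 1/t.\<close>

lemma flat_has_field_derivative:
  "(flat P has_field_derivative flat ([:0, 0, 1:] * (P - pderiv P)) t) (at t)"
proof -
  consider "t < 0" | "t = 0" | "t > 0" by linarith
  then show ?thesis
  proof cases
    case 1
    have "((\<lambda>_. 0) has_field_derivative flat ([:0, 0, 1:] * (P - pderiv P)) t) (at t)"
      using 1 by (simp add: flat_def)
    then show ?thesis
      by (rule has_field_derivative_transform_within_open[where S="{..<0}"])
        (use 1 in \<open>auto simp: flat_def\<close>)
  next
    case 2
    have left: "((\<lambda>h. flat P h / h) \<longlongrightarrow> 0) (at_left 0)"
      by (rule tendsto_eventually)
        (auto simp: flat_def eventually_at_filter intro!: always_eventually)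
    \<comment> \<open>With s = 1/h the difference quotient is s P(s) exp(-s);
      \<open>pCons 0 P\<close> is the polynomial s P(s).\<close>
    have "((\<lambda>h. poly (pCons 0 P) (inverse h) * exp (- inverse h)) \<longlongrightarrow> 0) (at_right 0)"
      by (rule filterlim_compose[OF tendsto_poly_times_exp_minus filterlim_inverse_at_top_right])
    then have right: "((\<lambda>h. flat P h / h) \<longlongrightarrow> 0) (at_right 0)"
      by (rule Lim_transform_eventually)
        (auto simp: flat_def eventually_at_filter field_simps intro!: always_eventually)
    show ?thesis
      using filterlim_split_at[OF left right] 2 by (simp add: DERIV_def flat_def)
  next
    case 3
    have "((\<lambda>t. poly P (1 / t) * exp (- (1 / t))) has_field_derivative
        flat ([:0, 0, 1:] * (P - pderiv P)) t) (at t)"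
      using 3 by (auto intro!: derivative_eq_intros poly_DERIV[THEN DERIV_chain2]
          simp: flat_def field_simps power2_eq_square)
    then show ?thesis
      by (rule has_field_derivative_transform_within_open[where S="{0<..}"])
        (use 3 in \<open>auto simp: flat_def\<close>)
  qed
qed

text \<open>The induction must run over all \<open>P\<close> at once, because differentiating
  replaces \<open>P\<close> by another polynomial.\<close>

lemma C_k_flat_compose:
  fixes q :: "'a::euclidean_space \<Rightarrow> real"
  assumes "\<And>k. C_k k q"
  shows "C_k k (\<lambda>x. flat P (q x))"
proof (induction k arbitrary: P)
  case 0
  have "continuous_on UNIV (flat P)"
    by (intro DERIV_continuous_on[OF flat_has_field_derivative])
  then show ?case
    using C_k_imp_continuous[OF assms] by (auto intro: continuous_on_compose2)
next
  case (Suc k)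
  let ?Q = "[:0, 0, 1:] * (P - pderiv P)"
  have "((\<lambda>x. flat P (q x)) has_derivative (\<lambda>h. flat ?Q (q x) * frechet_derivative q (at x) h)) (at x)" for x
    using has_derivative_compose[OF C_k_Suc_has_derivative[OF assms, of x]
        flat_has_field_derivative[of P "q x", unfolded has_field_derivative_def]]
    by simp
  then show ?case
    by (rule C_k_SucI) (rule C_k_mult[OF Suc], use assms[of "Suc k"] in simp)
qed

section \<open>Bump functions on boxes and compact supports\<close>

text \<open>\<open>flat 1\<close> is exp(-1/t) for t > 0 and 0 otherwise, so the factors for a
  coordinate are both positive exactly strictly between the two faces of the box.\<close>

definition box_bump :: "'a::euclidean_space \<Rightarrow> 'a \<Rightarrow> 'a \<Rightarrow> real" where
  "box_bump a b x = (\<Prod>i\<in>Basis. flat 1 (x \<bullet> i - a \<bullet> i) * flat 1 (b \<bullet> i - x \<bullet> i))"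

lemma C_k_box_bump: "C_k k (box_bump a b)"
proof -
  have 1: "C_k k (\<lambda>x. x \<bullet> i - a \<bullet> i)" for i :: 'a and k
    using C_k_add[OF C_k_inner_left C_k_const[of _ "- (a \<bullet> i)"], of k i] by simp
  have 2: "C_k k (\<lambda>x. b \<bullet> i - x \<bullet> i)" for i :: 'a and k
    using C_k_add[OF C_k_inner_left C_k_const[of _ "b \<bullet> i"], of k "- i"] by simp
  show ?thesis
    unfolding box_bump_def[abs_def] by (intro C_k_prod C_k_mult C_k_flat_compose 1 2)
qed

lemma box_bump_nonneg: "0 \<le> box_bump a b x"
  unfolding box_bump_def by (intro prod_nonneg) (auto simp: flat_def)

lemma box_bump_pos_iff: "0 < box_bump a b x \<longleftrightarrow> x \<in> box a b"
proof -
  have "box_bump a b x \<noteq> 0 \<longleftrightarrow> x \<in> box a b"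
    unfolding box_bump_def by (auto simp: flat_def mem_box not_le)
  then show ?thesis
    using box_bump_nonneg[of a b x] by linarith
qed

lemma box_bump_eq_0: "x \<notin> box a b \<Longrightarrow> box_bump a b x = 0"
  using box_bump_pos_iff[of a b x] box_bump_nonneg[of a b x] by linarith

text \<open>A closed subset of a compact set is compact, so any compact set off which
  \<open>f\<close> vanishes can replace the closed support.\<close>

lemma compactly_supported_iff:
  "compactly_supported f \<longleftrightarrow> (\<exists>K. compact K \<and> (\<forall>x. x \<notin> K \<longrightarrow> f x = 0))"
proof
  assume "compactly_supported f"
  then show "\<exists>K. compact K \<and> (\<forall>x. x \<notin> K \<longrightarrow> f x = 0)"
    unfolding compactly_supported_def
    by (intro exI[of _ "closure {x. f x \<noteq> 0}"]) (auto dest: contra_subsetD[OF closure_subset])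
next
  assume "\<exists>K. compact K \<and> (\<forall>x. x \<notin> K \<longrightarrow> f x = 0)"
  then obtain K where K: "compact K" "\<And>x. x \<notin> K \<Longrightarrow> f x = 0" by auto
  then have "closure {x. f x \<noteq> 0} \<subseteq> K"
    by (metis (mono_tags, lifting) closure_minimal compact_imp_closed mem_Collect_eq subsetI)
  then show "compactly_supported f"
    unfolding compactly_supported_def by (metis K(1) closed_closure compact_Int_closed inf.absorb_iff2)
qed

lemma compactly_supported_box_bump: "compactly_supported (box_bump a b)"
  unfolding compactly_supported_iff
  by (rule exI[of _ "cbox a b"]) (auto intro!: box_bump_eq_0 dest: subsetD[OF box_subset_cbox])

section \<open>Convolution and mollification\<close>

lemma integrable_lborel_compactly_supported_mult:
  fixes f g :: "'a::euclidean_space \<Rightarrow> real"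
  assumes "continuous_on UNIV f" "compactly_supported f" "continuous_on UNIV g"
  shows "integrable lborel (\<lambda>t. f t * g t)"
proof -
  obtain K where K: "compact K" "\<And>x. x \<notin> K \<Longrightarrow> f x = 0"
    using assms(2) compactly_supported_iff by blast
  have "integrable lborel (\<lambda>t. indicator K t *\<^sub>R (f t * g t))"
    using assms by (intro borel_integrable_compact K continuous_intros)
      (auto intro: continuous_on_subset)
  moreover have "indicator K t *\<^sub>R (f t * g t) = f t * g t" for t
    using K(2) by (auto simp: indicator_def)
  ultimately show ?thesis by (simp only:)
qed

text \<open>The affine map t -> x - t has Jacobian factor |-1|^d = 1, hence preserves Lebesgue
  measure.\<close>

lemma integral_lborel_reflect:
  fixes h :: "'a::euclidean_space \<Rightarrow> real"
  assumes [measurable]: "h \<in> borel_measurable borel"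
  shows "(\<integral>t. h (x - t) \<partial>lborel) = (\<integral>t. h t \<partial>lborel)"
proof -
  have "lborel = density (distr lborel borel (\<lambda>t. x + (- 1) *\<^sub>R t)) (\<lambda>_. ennreal (\<bar>- 1\<bar> ^ DIM('a)))"
    using lborel_affine[of "- 1" x] by simp
  then have "lborel = distr lborel borel (\<lambda>t. x - t)"
    by (simp add: density_1)
  then have "(\<integral>t. h t \<partial>lborel) = (\<integral>t. h t \<partial>distr lborel borel (\<lambda>t. x - t))"
    by simp
  also have "\<dots> = (\<integral>t. h (x - t) \<partial>lborel)"
    by (rule integral_distr) auto
  finally show ?thesis by simp
qed

section \<open>Convolution\<close>

text \<open>\<open>x\<close> enters only through \<open>g\<close>, so derivatives of a convolution
  fall on the second factor; \<open>conv_commute\<close> moves them to the other one.\<close>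

definition conv :: "('a::euclidean_space \<Rightarrow> real) \<Rightarrow> ('a \<Rightarrow> real) \<Rightarrow> 'a \<Rightarrow> real" where
  "conv f g x = (\<integral>t. f t * g (x - t) \<partial>lborel)"

lemma conv_commute:
  assumes "f \<in> borel_measurable borel" "g \<in> borel_measurable borel"
  shows "conv f g = conv g f"
proof
  fix x
  have "(\<lambda>t. f t * g (x - t)) \<in> borel_measurable borel"
    using assms by measurable
  from integral_lborel_reflect[OF this, of x] show "conv f g x = conv g f x"
    by (simp add: conv_def mult.commute)
qed

text \<open>Passing to a gauge integral over a fixed box makes the Leibniz rule for parameter
  integrals applicable.\<close>

lemma conv_eq_integral_cbox:
  assumes "continuous_on UNIV f" "\<And>t. t \<notin> cbox a b \<Longrightarrow> f t = 0" "continuous_on UNIV g"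
  shows "conv f g x = integral (cbox a b) (\<lambda>t. f t * g (x - t))"
proof -
  have "compactly_supported f"
    using assms(2) compactly_supported_iff compact_cbox by blast
  moreover have "continuous_on UNIV (\<lambda>t. g (x - t))"
    by (intro continuous_on_compose2[OF assms(3)] continuous_intros) auto
  ultimately have "integrable lborel (\<lambda>t. f t * g (x - t))"
    using assms(1) integrable_lborel_compactly_supported_mult by blast
  then have "conv f g x = integral UNIV (\<lambda>t. f t * g (x - t))"
    by (simp add: conv_def integral_lborel)
  also have "\<dots> = integral UNIV (\<lambda>t. if t \<in> cbox a b then f t * g (x - t) else 0)"
    using assms(2) by (intro arg_cong2[where f=integral]) auto
  finally show ?thesis by (simp add: integral_restrict_UNIV)
qed

lemma conv_has_derivative:
  fixes f g :: "'a::euclidean_space \<Rightarrow> real"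
  assumes f: "continuous_on UNIV f" "compactly_supported f" and g: "C_k 1 g"
  shows "(conv f g has_derivative (\<lambda>h. conv f (\<lambda>y. frechet_derivative g (at y) h) x)) (at x)"
proof -
  obtain K where K: "compact K" "\<And>x. x \<notin> K \<Longrightarrow> f x = 0"
    using f(2) compactly_supported_iff by blast
  obtain a b where "K \<subseteq> cbox a b"
    using bounded_subset_cbox_symmetric[OF compact_imp_bounded[OF K(1)]] by metis
  then have ab: "\<And>t. t \<notin> cbox a b \<Longrightarrow> f t = 0"
    using K(2) by blast
  \<comment> \<open>The Leibniz rule asks for a derivative that is continuous as a map into bounded
    linear functionals; in finite dimension, continuity in each fixed direction gives this.\<close>
  define Dg where "Dg y = Blinfun (frechet_derivative g (at y))" for y
  have gD: "(g has_derivative frechet_derivative g (at y)) (at y)" for y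
    using g C_k_Suc_has_derivative by (metis One_nat_def)
  have Dg: "blinfun_apply (Dg y) = frechet_derivative g (at y)" for y
    unfolding Dg_def by (intro bounded_linear_Blinfun_apply has_derivative_bounded_linear[OF gD])
  have contg: "continuous_on UNIV g"
    using g C_k_imp_continuous by blast
  have contD: "continuous_on UNIV (\<lambda>y. frechet_derivative g (at y) h)" for h
    using g by simp
  have contDg: "continuous_on UNIV Dg"
    by (rule continuous_on_blinfun_componentwise) (simp add: Dg contD)
  have "((\<lambda>x. integral (cbox a b) (\<lambda>t. f t * g (x - t))) has_derivative
        integral (cbox a b) (\<lambda>t. f t *\<^sub>R Dg (x - t))) (at x within UNIV)"
  proof (rule leibniz_rule)
    show "((\<lambda>x. f t * g (x - t)) has_derivative blinfun_apply (f t *\<^sub>R Dg (x - t))) (at x within UNIV)" for x t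
    proof -
      have "((\<lambda>x. g (x - t)) has_derivative (\<lambda>h. frechet_derivative g (at (x - t)) h)) (at x)"
        by (rule has_derivative_compose[OF _ gD, of "\<lambda>x. x - t" "\<lambda>h. h"]) (auto intro!: derivative_eq_intros)
      from has_derivative_mult_right[OF this, of "f t"] show ?thesis
        by (simp add: Dg scaleR_blinfun.rep_eq)
    qed
    show "(\<lambda>t. f t * g (x - t)) integrable_on cbox a b" for x
      by (intro integrable_continuous continuous_intros continuous_on_subset[OF f(1)]
          continuous_on_compose2[OF contg]) auto
    show "continuous_on (UNIV \<times> cbox a b) (\<lambda>(x, t). f t *\<^sub>R Dg (x - t))"
      unfolding case_prod_beta
      by (intro continuous_intros continuous_on_compose2[OF f(1)] continuous_on_compose2[OF contDg]) auto
  qed auto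
  moreover have "blinfun_apply (integral (cbox a b) (\<lambda>t. f t *\<^sub>R Dg (x - t))) =
      (\<lambda>h. conv f (\<lambda>y. frechet_derivative g (at y) h) x)"
  proof
    fix h
    have "(\<lambda>t. f t *\<^sub>R Dg (x - t)) integrable_on cbox a b"
      by (intro integrable_continuous continuous_intros continuous_on_subset[OF f(1)]
          continuous_on_compose2[OF contDg]) auto
    then show "blinfun_apply (integral (cbox a b) (\<lambda>t. f t *\<^sub>R Dg (x - t))) h =
        conv f (\<lambda>y. frechet_derivative g (at y) h) x"
      by (simp add: blinfun_apply_integral conv_eq_integral_cbox[OF f(1) ab contD] Dg scaleR_blinfun.rep_eq)
  qed
  moreover have "(\<lambda>x. integral (cbox a b) (\<lambda>t. f t * g (x - t))) = conv f g"
    using conv_eq_integral_cbox[OF f(1) ab contg] by auto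
  ultimately show ?thesis
    by simp
qed

lemma C_k_conv:
  assumes f: "continuous_on UNIV f" "compactly_supported f" and "\<And>k. C_k k g"
  shows "C_k k (conv f g)"
  using assms(3)
proof (induction k arbitrary: g)
  case 0
  have "isCont (conv f g) x" for x
    by (rule has_derivative_continuous[OF conv_has_derivative[OF f 0]])
  then show ?case
    by (simp add: continuous_on_eq_continuous_at)
next
  case (Suc k)
  show ?case
    by (rule C_k_SucI[OF conv_has_derivative[OF f Suc.prems]])
      (rule Suc.IH, use Suc.prems[of "Suc _"] in simp)
qed

text \<open>The convolution vanishes off the sum of the two compact sets, which is compact.\<close>

lemma compactly_supported_conv:
  assumes "compactly_supported f" "compactly_supported g"
  shows "compactly_supported (conv f g)"
proof -
  obtain K L where K: "compact K" "\<And>x. x \<notin> K \<Longrightarrow> f x = 0" and L: "compact L" "\<And>x. x \<notin> L \<Longrightarrow> g x = 0"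
    using assms compactly_supported_iff by metis
  have "conv f g x = 0" if "x \<notin> {s + t | s t. s \<in> K \<and> t \<in> L}" for x
  proof -
    have "f t * g (x - t) = 0" for t
      using that K(2)[of t] L(2)[of "x - t"] by (cases "t \<in> K"; cases "x - t \<in> L") force+
    then show ?thesis by (simp only: conv_def) simp
  qed
  then show ?thesis
    using compact_sums[OF K(1) L(1)] compactly_supported_iff by blast
qed

section \<open>Mollifiers and approximation of \<open>C1_c\<close> by test forms\<close>

text \<open>A bump on a box inside the ball, divided by its integral.\<close>

lemma mollifier_exists:
  assumes "0 < e"
  obtains \<rho> :: "'a::euclidean_space \<Rightarrow> real"
  where "\<And>k. C_k k \<rho>" "\<And>x. 0 \<le> \<rho> x" "\<And>x. x \<notin> ball 0 e \<Longrightarrow> \<rho> x = 0" "(\<integral>x. \<rho> x \<partial>lborel) = 1"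
proof -
  obtain a b :: 'a where ab: "0 \<in> box a b" "box a b \<subseteq> ball 0 e"
    using rational_boxes[OF assms, of "0 :: 'a"] by metis
  define c where "c = (\<integral>x. box_bump a b x \<partial>lborel)"
  have int: "integrable lborel (box_bump a b)"
    using integrable_lborel_compactly_supported_mult[OF C_k_imp_continuous[OF C_k_box_bump]
        compactly_supported_box_bump, of "\<lambda>_. 1"] by simp
  \<comment> \<open>A zero integral would make the bump vanish almost everywhere, yet it is positive
    on a nonempty open box, which is not negligible.\<close>
  have "c \<noteq> 0"
  proof
    assume "c = 0"
    then have "AE x in lborel. box_bump a b x = 0"
      using int box_bump_nonneg integral_nonneg_eq_0_iff_AE unfolding c_def by blast
    then have "AE x in lborel. x \<notin> box a b"
      by (rule AE_mp) (auto simp flip: box_bump_pos_iff)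
    then have "emeasure lborel (box a b) = 0"
      by (subst (asm) AE_iff_measurable[where N="box a b"]) auto
    then have "negligible (box a b)"
      by (auto simp: negligible_iff_null_sets null_sets_def)
    then show False
      using ab(1) open_not_negligible[OF open_box, of a b] by blast
  qed
  moreover have "0 \<le> c"
    unfolding c_def by (intro integral_nonneg_AE) (simp add: box_bump_nonneg)
  ultimately have c: "0 < c" by simp
  show thesis
  proof
    show "C_k k (\<lambda>x. 1 / c * box_bump a b x)" for k
      by (intro C_k_mult C_k_const C_k_box_bump)
    show "0 \<le> 1 / c * box_bump a b x" for x
      using c box_bump_nonneg[of a b x] by simp
    show "1 / c * box_bump a b x = 0" if "x \<notin> ball 0 e" for x
      using that ab(2) box_bump_eq_0[of x a b] by (cases "x \<in> box a b") auto
    show "(\<integral>x. 1 / c * box_bump a b x \<partial>lborel) = 1"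
      using c by (simp add: c_def)
  qed
qed

text \<open>\<open>conv \<rho> g x\<close> is an average of the values of \<open>g\<close> near
  \<open>x\<close>, weighted by \<open>\<rho>\<close>. With \<open>c = 0\<close> this shows that
  mollifying preserves sup bounds; with \<open>c\<close> the value at \<open>x\<close>, it gives
  convergence.\<close>

lemma abs_conv_diff_le:
  fixes \<rho> g :: "'a::euclidean_space \<Rightarrow> real"
  assumes \<rho>: "continuous_on UNIV \<rho>" "compactly_supported \<rho>" "\<And>x. 0 \<le> \<rho> x" "(\<integral>x. \<rho> x \<partial>lborel) = 1"
    and g: "continuous_on UNIV g"
    and near: "\<And>t. \<rho> t \<noteq> 0 \<Longrightarrow> \<bar>g (x - t) - c\<bar> \<le> B"
  shows "\<bar>conv \<rho> g x - c\<bar> \<le> B"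
proof -
  have cont: "continuous_on UNIV (\<lambda>t. g (x - t))"
    by (intro continuous_on_compose2[OF g] continuous_intros) auto
  have int: "integrable lborel (\<lambda>t. \<rho> t * h t)" if "continuous_on UNIV h" for h
    using integrable_lborel_compactly_supported_mult[OF \<rho>(1,2) that] .
  have "conv \<rho> g x - c = (\<integral>t. \<rho> t * g (x - t) \<partial>lborel) - (\<integral>t. \<rho> t * c \<partial>lborel)"
    by (simp add: conv_def \<rho>(4))
  also have "\<dots> = (\<integral>t. \<rho> t * (g (x - t) - c) \<partial>lborel)"
    using int[OF cont] int[OF continuous_on_const]
    by (subst Bochner_Integration.integral_diff[symmetric]) (auto simp: algebra_simps)
  also have "\<bar>\<dots>\<bar> \<le> (\<integral>t. \<rho> t * B \<partial>lborel)"
  proof (rule integral_abs_bound_integral)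
    show "integrable lborel (\<lambda>t. \<rho> t * (g (x - t) - c))"
      by (intro int continuous_intros cont)
    show "integrable lborel (\<lambda>t. \<rho> t * B)"
      by (intro int continuous_intros)
    show "\<bar>\<rho> t * (g (x - t) - c)\<bar> \<le> \<rho> t * B" for t
      using near[of t] \<rho>(3)[of t] by (cases "\<rho> t = 0") (auto simp: abs_mult intro: mult_left_mono)
  qed
  finally show ?thesis by (simp add: \<rho>(4))
qed

text \<open>The mollified function and its derivative in a fixed direction are averages of those of
  \<open>w\<close>, so they inherit the same bounds, and continuity of the derivative gives
  pointwise convergence.\<close>

lemma C1_c_approx_test_forms:
  fixes w :: "'a::euclidean_space \<Rightarrow> real"
  assumes w: "w \<in> C1_c"
  obtains W where "\<And>n. W n \<in> test_forms"
    "\<And>n B. (\<And>x. \<bar>w x\<bar> \<le> B) \<Longrightarrow> \<forall>x. \<bar>W n x\<bar> \<le> B"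
    "\<And>n h B. (\<And>x. \<bar>frechet_derivative w (at x) h\<bar> \<le> B) \<Longrightarrow> \<forall>x. \<bar>frechet_derivative (W n) (at x) h\<bar> \<le> B"
    "\<And>x h. (\<lambda>n. frechet_derivative (W n) (at x) h) \<longlonglongrightarrow> frechet_derivative w (at x) h"
proof -
  have w1: "C_k 1 w" and wc: "compactly_supported w"
    using w by (auto simp: C1_c_def)
  have contw: "continuous_on UNIV w"
    using w1 C_k_imp_continuous by blast
  have contD: "continuous_on UNIV (\<lambda>x. frechet_derivative w (at x) h)" for h
    using w1 by simp
  have "\<exists>\<rho> :: 'a \<Rightarrow> real. (\<forall>k. C_k k \<rho>) \<and> (\<forall>x. 0 \<le> \<rho> x) \<and> (\<forall>x. x \<notin> ball 0 (inverse (Suc n)) \<longrightarrow> \<rho> x = 0)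
      \<and> (\<integral>x. \<rho> x \<partial>lborel) = 1" for n
    using mollifier_exists[of "inverse (Suc n)"] by (metis inverse_positive_iff_positive of_nat_0_less_iff zero_less_Suc)
  then obtain \<rho> :: "nat \<Rightarrow> 'a \<Rightarrow> real" where \<rho>: "\<And>n k. C_k k (\<rho> n)" "\<And>n x. 0 \<le> \<rho> n x"
      "\<And>n x. x \<notin> ball 0 (inverse (Suc n)) \<Longrightarrow> \<rho> n x = 0" "\<And>n. (\<integral>x. \<rho> n x \<partial>lborel) = 1"
    by metis
  have \<rho>c: "continuous_on UNIV (\<rho> n)" for n
    using \<rho>(1) C_k_imp_continuous by blast
  have \<rho>s: "compactly_supported (\<rho> n)" for n
    unfolding compactly_supported_iff
    by (rule exI[of _ "cball 0 (inverse (Suc n))"]) (auto intro!: \<rho>(3))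
  define W where "W n = conv (\<rho> n) w" for n
  \<comment> \<open>The two orders serve different ends: with \<open>\<rho> n\<close> second the
    convolution is smooth, with \<open>w\<close> second its derivative is the mollified derivative
    of \<open>w\<close>.\<close>
  have Wc: "W n = conv w (\<rho> n)" for n
    unfolding W_def by (intro conv_commute borel_measurable_continuous_onI contw \<rho>c)
  have DW: "frechet_derivative (W n) (at x) = (\<lambda>h. conv (\<rho> n) (\<lambda>y. frechet_derivative w (at y) h) x)" for n x
    using frechet_derivative_at[OF conv_has_derivative[OF \<rho>c \<rho>s w1]] unfolding W_def by simp
  note bound = abs_conv_diff_le[OF \<rho>c \<rho>s \<rho>(2) \<rho>(4)]
  show thesis
  proof
    show "W n \<in> test_forms" for n
      unfolding test_forms_def
      using C_k_conv[OF contw wc \<rho>(1)] compactly_supported_conv[OF wc \<rho>s] by (simp add: Wc)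
    show "\<forall>x. \<bar>W n x\<bar> \<le> B" if "\<And>x. \<bar>w x\<bar> \<le> B" for n B
      using bound[OF contw, where c=0] that unfolding W_def by simp
    show "\<forall>x. \<bar>frechet_derivative (W n) (at x) h\<bar> \<le> B"
      if "\<And>x. \<bar>frechet_derivative w (at x) h\<bar> \<le> B" for n h B
      using bound[OF contD, where c=0] that unfolding DW by simp
    show "(\<lambda>n. frechet_derivative (W n) (at x) h) \<longlonglongrightarrow> frechet_derivative w (at x) h" for x h
    proof (rule LIMSEQ_I)
      fix r :: real assume "0 < r"
      then obtain d where d: "0 < d"
          "\<And>y. dist y x < d \<Longrightarrow> dist (frechet_derivative w (at y) h) (frechet_derivative w (at x) h) < r / 2"
        using contD[of h] unfolding continuous_on_iff by (metis UNIV_I half_gt_zero)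
      obtain N where N: "inverse (real (Suc N)) < d"
        using reals_Archimedean[OF d(1)] by blast
      \<comment> \<open>\<open>r / 2\<close> leaves room for the strict inequality, since averaging
        yields only a weak one.\<close>
      have "\<bar>conv (\<rho> n) (\<lambda>y. frechet_derivative w (at y) h) x - frechet_derivative w (at x) h\<bar> \<le> r / 2"
        if "n \<ge> N" for n
      proof (rule bound[OF contD])
        fix t assume "\<rho> n t \<noteq> 0"
        then have "norm t < inverse (Suc n)"
          using \<rho>(3)[of t n] by auto
        also have "\<dots> \<le> inverse (Suc N)"
          using that by simp
        finally have "dist (x - t) x < d"
          using N by (simp add: dist_norm)
        then show "\<bar>frechet_derivative w (at (x - t)) h - frechet_derivative w (at x) h\<bar> \<le> r / 2"
          using d(2) by (fastforce simp: dist_real_def)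
      qed
      then show "\<exists>N. \<forall>n\<ge>N. norm (frechet_derivative (W n) (at x) h - frechet_derivative w (at x) h) < r"
        unfolding DW using \<open>0 < r\<close> by (intro exI[of _ N]) (force simp: real_norm_def)
    qed
  qed
qed

section \<open>Functions of class C1 with compact support\<close>

lemma C_k_1_compose_real:
  fixes u :: "'a::euclidean_space \<Rightarrow> real"
  assumes F: "\<And>t. (F has_real_derivative F' t) (at t)" and F': "continuous_on UNIV F'" and u: "C_k 1 u"
  shows "C_k 1 (\<lambda>x. F (u x))"
    and "((\<lambda>x. F (u x)) has_derivative (\<lambda>h. F' (u x) * frechet_derivative u (at x) h)) (at x)"
proof -
  show D: "((\<lambda>x. F (u x)) has_derivative (\<lambda>h. F' (u x) * frechet_derivative u (at x) h)) (at x)" for x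
  proof -
    have "(u has_derivative frechet_derivative u (at x)) (at x)"
      using u by (intro C_k_Suc_has_derivative[of 0]) simp
    then show ?thesis
      using F[of "u x", unfolded has_field_derivative_def] by (rule has_derivative_compose)
  qed
  have "continuous_on UNIV (\<lambda>x. F' (u x))"
    by (rule continuous_on_compose2[OF F' C_k_imp_continuous[OF u]]) simp
  then have "continuous_on UNIV (\<lambda>x. F' (u x) * frechet_derivative u (at x) h)" for h
    by (rule continuous_on_mult) (use u in simp)
  then have "C_k 0 (\<lambda>x. F' (u x) * frechet_derivative u (at x) h)" for h
    by simp
  from C_k_SucI[where f'="\<lambda>x h. F' (u x) * frechet_derivative u (at x) h", OF D this]
  show "C_k 1 (\<lambda>x. F (u x))" by simp
qed

lemma C1_c_has_derivative:
  "u \<in> C1_c \<Longrightarrow> (u has_derivative frechet_derivative u (at x)) (at x)"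
  by (auto simp: C1_c_def frechet_derivative_works[symmetric])

lemma C1_c_continuous_derivative:
  "u \<in> C1_c \<Longrightarrow> continuous_on UNIV (\<lambda>x. frechet_derivative u (at x) h)"
  by (simp add: C1_c_def)

lemma C1_c_continuous: "u \<in> C1_c \<Longrightarrow> continuous_on UNIV u"
  by (auto simp: C1_c_def simp del: C_k.simps dest: C_k_imp_continuous)

lemma C1_c_derivative_basis:
  assumes "u \<in> C1_c"
  shows "frechet_derivative u (at x) h = (\<Sum>i\<in>Basis. (h \<bullet> i) * frechet_derivative u (at x) i)"
proof -
  have lin: "linear (frechet_derivative u (at x))"
    using has_derivative_linear[OF C1_c_has_derivative[OF assms]] .
  have "frechet_derivative u (at x) h = frechet_derivative u (at x) (\<Sum>i\<in>Basis. (h \<bullet> i) *\<^sub>R i)"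
    by (simp add: euclidean_representation)
  also have "\<dots> = (\<Sum>i\<in>Basis. (h \<bullet> i) * frechet_derivative u (at x) i)"
    using lin by (simp add: linear_sum linear_scale)
  finally show ?thesis .
qed

lemma C1_c_mult:
  assumes "C_k 1 f" "g \<in> C1_c"
  shows "(\<lambda>x. f x * g x) \<in> C1_c"
proof -
  have g: "C_k 1 g" "compactly_supported g"
    using assms(2) by (auto simp: C1_c_def)
  have "compactly_supported (\<lambda>x. f x * g x)"
    using g(2) unfolding compactly_supported_iff by (metis mult_zero_right)
  with C_k_mult[OF assms(1) g(1)] show ?thesis
    by (simp add: C1_c_def)
qed

text \<open>\<open>F 0 = 0\<close> is what keeps the support compact.\<close>

lemma C1_c_compose_real:
  assumes F: "\<And>t. (F has_real_derivative F' t) (at t)" "continuous_on UNIV F'" "F 0 = 0" and u: "u \<in> C1_c"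
  shows "(\<lambda>x. F (u x)) \<in> C1_c"
proof -
  have "C_k 1 u" "compactly_supported u"
    using u by (auto simp: C1_c_def)
  then have "C_k 1 (\<lambda>x. F (u x))" "compactly_supported (\<lambda>x. F (u x))"
    using C_k_1_compose_real(1)[OF F(1,2)] F(3) by (auto simp: compactly_supported_iff simp del: C_k.simps)
  then show ?thesis by (simp add: C1_c_def)
qed

lemma C1_c_diff:
  assumes "u \<in> C1_c" "w \<in> C1_c"
  shows "(\<lambda>x. u x - w x) \<in> C1_c"
    and "frechet_derivative (\<lambda>x. u x - w x) (at x) h = frechet_derivative u (at x) h - frechet_derivative w (at x) h"
proof -
  have u: "C_k 1 u" "compactly_supported u" and w: "C_k 1 w" "compactly_supported w"
    using assms by (auto simp: C1_c_def)
  have "C_k 1 (\<lambda>x. u x + (- 1) * w x)"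
    by (intro C_k_add C_k_mult C_k_const u w)
  then have "C_k 1 (\<lambda>x. u x - w x)" by simp
  moreover obtain K L where "compact K" "\<And>x. x \<notin> K \<Longrightarrow> u x = 0" "compact L" "\<And>x. x \<notin> L \<Longrightarrow> w x = 0"
    using u(2) w(2) compactly_supported_iff by metis
  then have "compactly_supported (\<lambda>x. u x - w x)"
    unfolding compactly_supported_iff by (intro exI[of _ "K \<union> L"]) auto
  ultimately show "(\<lambda>x. u x - w x) \<in> C1_c"
    by (simp add: C1_c_def)
  have "((\<lambda>x. u x - w x) has_derivative (\<lambda>h. frechet_derivative u (at x) h - frechet_derivative w (at x) h)) (at x)"
    by (intro has_derivative_diff C1_c_has_derivative assms)
  from frechet_derivative_at[OF this, symmetric]
  show "frechet_derivative (\<lambda>x. u x - w x) (at x) h = frechet_derivative u (at x) h - frechet_derivative w (at x) h"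
    by simp
qed

section \<open>Bounds on functions in \<open>C1_c\<close> and their derivatives\<close>

lemma bounded_of_compactly_supported:
  fixes f :: "'a::euclidean_space \<Rightarrow> real"
  assumes "continuous_on UNIV f" "compactly_supported f"
  obtains B where "0 < B" "\<And>x. \<bar>f x\<bar> \<le> B"
proof -
  obtain K where K: "compact K" "\<And>x. x \<notin> K \<Longrightarrow> f x = 0"
    using assms(2) compactly_supported_iff by blast
  have "bounded (f ` K)"
    by (intro compact_imp_bounded compact_continuous_image K(1) continuous_on_subset[OF assms(1)]) simp
  then obtain B where B: "0 < B" "\<And>x. x \<in> K \<Longrightarrow> \<bar>f x\<bar> \<le> B"
    by (auto simp: bounded_pos)
  have "\<bar>f x\<bar> \<le> B" for x
    using B K(2) by (cases "x \<in> K") auto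
  with that B(1) show thesis by blast
qed

lemma C1_c_bounded:
  assumes "u \<in> C1_c"
  obtains B where "0 < B" "\<And>x. \<bar>u x\<bar> \<le> B"
  using assms bounded_of_compactly_supported[OF C1_c_continuous[OF assms]] by (auto simp: C1_c_def)

lemma C1_c_derivative_bounded:
  assumes u: "u \<in> C1_c"
  obtains B where "0 < B" "\<And>x. \<bar>frechet_derivative u (at x) h\<bar> \<le> B"
proof -
  obtain K where K: "compact K" "\<And>x. x \<notin> K \<Longrightarrow> u x = 0"
    using u compactly_supported_iff unfolding C1_c_def by blast
  \<comment> \<open>The complement of \<open>K\<close> is open and \<open>u\<close> is 0 on it, so
    the derivative is 0 there too.\<close>
  have "frechet_derivative u (at x) h = 0" if "x \<notin> K" for x
  proof -
    have "(u has_derivative (\<lambda>_. 0)) (at x)"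
      by (rule has_derivative_transform_within_open[OF has_derivative_const, of "- K"])
        (use K that compact_imp_closed in auto)
    then show ?thesis
      using frechet_derivative_at by metis
  qed
  then have "compactly_supported (\<lambda>x. frechet_derivative u (at x) h)"
    using K(1) compactly_supported_iff by blast
  then show thesis
    using bounded_of_compactly_supported[OF C1_c_continuous_derivative[OF u]] that by blast
qed

text \<open>Mollification controls derivatives only in fixed directions; expanding \<open>h\<close>
  in the basis turns these bounds into one that is valid for directions varying with the point, such
  as \<open>\<tau> x\<close>.\<close>

lemma abs_derivative_le_of_basis:
  assumes u: "u \<in> C1_c" and B: "\<And>i. i \<in> Basis \<Longrightarrow> \<bar>frechet_derivative u (at x) i\<bar> \<le> B i"
  shows "\<bar>frechet_derivative u (at x) h\<bar> \<le> (\<Sum>i\<in>Basis. B i) * norm h"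
proof -
  have "\<bar>frechet_derivative u (at x) h\<bar> \<le> (\<Sum>i\<in>Basis. \<bar>(h \<bullet> i) * frechet_derivative u (at x) i\<bar>)"
    unfolding C1_c_derivative_basis[OF u, of x h] by (rule sum_abs)
  also have "\<dots> \<le> (\<Sum>i\<in>Basis. norm h * B i)"
    by (intro sum_mono) (auto simp: abs_mult intro!: mult_mono B Basis_le_norm)
  finally show ?thesis
    by (simp add: sum_distrib_left mult.commute)
qed

lemma C1_c_derivative_bounded_norm:
  assumes u: "u \<in> C1_c"
  obtains B where "0 < B" "\<And>x h. \<bar>frechet_derivative u (at x) h\<bar> \<le> B * norm h"
proof -
  have "\<exists>B>0. \<forall>x. \<bar>frechet_derivative u (at x) i\<bar> \<le> B" for i
    using C1_c_derivative_bounded[OF u, of i] by metis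
  then obtain B where B: "\<And>i. 0 < B i" "\<And>i x. \<bar>frechet_derivative u (at x) i\<bar> \<le> B i"
    by metis
  show thesis
    using that[of "\<Sum>i\<in>Basis. B i"] abs_derivative_le_of_basis[OF u B(2)] B(1)
    by (simp add: sum_pos)
qed

section \<open>Derivatives along \<tau> and the boundary of the current\<close>

text \<open>In the basis, the derivative along \<open>\<tau> x\<close> is a finite sum of products
  of coordinates of \<tau> and continuous partial derivatives.\<close>

lemma C1_c_derivative_measurable:
  assumes u: "u \<in> C1_c" and "sets \<mu> = sets borel" and [measurable]: "\<tau> \<in> borel_measurable \<mu>"
  shows "(\<lambda>x. frechet_derivative u (at x) (\<tau> x)) \<in> borel_measurable \<mu>"
proof -
  have [measurable]: "(\<lambda>x. frechet_derivative u (at x) i) \<in> borel_measurable \<mu>" for i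
    using borel_measurable_continuous_onI[OF C1_c_continuous_derivative[OF u]]
      measurable_cong_sets[OF assms(2) refl] by blast
  show ?thesis
    unfolding C1_c_derivative_basis[OF u, of _ "\<tau> _"] by measurable
qed

lemma C1_c_derivative_integrable:
  assumes u: "u \<in> C1_c" and "sets \<mu> = sets borel" and \<tau>: "integrable \<mu> \<tau>"
  shows "integrable \<mu> (\<lambda>x. frechet_derivative u (at x) (\<tau> x))"
proof -
  obtain B where B: "0 < B" "\<And>x h. \<bar>frechet_derivative u (at x) h\<bar> \<le> B * norm h"
    using C1_c_derivative_bounded_norm[OF u] by metis
  show ?thesis
  proof (rule Bochner_Integration.integrable_bound)
    show "integrable \<mu> (\<lambda>x. B * norm (\<tau> x))"
      using \<tau> by simp
    show "(\<lambda>x. frechet_derivative u (at x) (\<tau> x)) \<in> borel_measurable \<mu>"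
      using C1_c_derivative_measurable assms borel_measurable_integrable by blast
  qed (use B in auto)
qed

text \<open>\<open>Blinfun\<close> is meaningful only on bounded linear maps; differentiability of
  test forms provides this.\<close>

lemma boundary_vector_measure_current:
  assumes "\<phi> \<in> test_forms"
  shows "boundary (vector_measure_current \<tau> \<mu>) \<phi> = (\<integral>x. frechet_derivative \<phi> (at x) (\<tau> x) \<partial>\<mu>)"
proof -
  have "C_k (Suc 0) \<phi>"
    using assms unfolding test_forms_def by blast
  then have "bounded_linear (frechet_derivative \<phi> (at x))" for x
    by (intro has_derivative_bounded_linear[OF C_k_Suc_has_derivative])
  then show ?thesis
    by (simp add: boundary_def vector_measure_current_def differential_def bounded_linear_Blinfun_apply)
qed

lemma test_forms_subset_C1_c: "test_forms \<subseteq> C1_c"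
  unfolding test_forms_def C1_c_def by blast

text \<open>The bound on test forms passes to \<open>C1_c\<close> by mollification.\<close>

lemma boundary_mass_bound:
  fixes \<tau> :: "'a::euclidean_space \<Rightarrow> 'a"
  assumes fin: "mass (boundary (vector_measure_current \<tau> \<mu>)) < \<infinity>"
    and sets: "sets \<mu> = sets borel" and \<tau>: "integrable \<mu> \<tau>"
  obtains M where "\<And>w B. w \<in> C1_c \<Longrightarrow> 0 < B \<Longrightarrow> (\<And>x. \<bar>w x\<bar> \<le> B) \<Longrightarrow>
    (\<integral>x. frechet_derivative w (at x) (\<tau> x) \<partial>\<mu>) \<le> M * B"
proof -
  let ?L = "\<lambda>w. \<integral>x. frechet_derivative w (at x) (\<tau> x) \<partial>\<mu>"
  obtain M where M: "mass (boundary (vector_measure_current \<tau> \<mu>)) \<le> ereal M"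
    using fin by (cases "mass (boundary (vector_measure_current \<tau> \<mu>))") auto
  have unit: "?L \<phi> \<le> M" if "\<phi> \<in> test_forms" "\<And>x. \<bar>\<phi> x\<bar> \<le> 1" for \<phi>
  proof -
    have "ereal (boundary (vector_measure_current \<tau> \<mu>) \<phi>) \<le> mass (boundary (vector_measure_current \<tau> \<mu>))"
      unfolding mass_def by (rule SUP_upper) (use that in auto)
    also note M
    finally show ?thesis
      using boundary_vector_measure_current[OF that(1)] by simp
  qed
  \<comment> \<open>\<open>mass\<close> tests forms bounded by 1, so the form is rescaled by
    1/B.\<close>
  have smooth: "?L \<phi> \<le> M * B" if \<phi>: "\<phi> \<in> test_forms" and "0 < B" "\<And>x. \<bar>\<phi> x\<bar> \<le> B" for \<phi> B
  proof -
    have "\<phi> \<in> C1_c"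
      using \<phi> test_forms_subset_C1_c by blast
    from has_derivative_mult_right[OF C1_c_has_derivative[OF this], of "1 / B"]
    have D: "frechet_derivative (\<lambda>x. 1 / B * \<phi> x) (at x) = (\<lambda>h. 1 / B * frechet_derivative \<phi> (at x) h)" for x
      by (rule frechet_derivative_at[symmetric])
    have "compactly_supported (\<lambda>x. 1 / B * \<phi> x)"
      using \<phi> unfolding test_forms_def compactly_supported_iff by (auto intro: exI)
    then have "(\<lambda>x. 1 / B * \<phi> x) \<in> test_forms"
      using \<phi> C_k_mult[OF C_k_const] unfolding test_forms_def by blast
    then have "?L (\<lambda>x. 1 / B * \<phi> x) \<le> M"
      using that by (intro unit) (auto simp: abs_mult)
    then show ?thesis
      unfolding D using \<open>0 < B\<close> by (simp add: field_simps)
  qed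
  have "?L w \<le> M * B" if w: "w \<in> C1_c" and "0 < B" and wB: "\<And>x. \<bar>w x\<bar> \<le> B" for w B
  proof -
    obtain W where W: "\<And>n. W n \<in> test_forms" "\<And>n x. \<bar>W n x\<bar> \<le> B"
      "\<And>n h C. (\<And>x. \<bar>frechet_derivative w (at x) h\<bar> \<le> C) \<Longrightarrow> \<forall>x. \<bar>frechet_derivative (W n) (at x) h\<bar> \<le> C"
      "\<And>x h. (\<lambda>n. frechet_derivative (W n) (at x) h) \<longlonglongrightarrow> frechet_derivative w (at x) h"
      using C1_c_approx_test_forms[OF w] wB by metis
    have WC: "W n \<in> C1_c" for n
      using W(1) test_forms_subset_C1_c by blast
    have "\<exists>C. \<forall>x. \<bar>frechet_derivative w (at x) h\<bar> \<le> C" for h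
      using C1_c_derivative_bounded[OF w] by metis
    then obtain C where C: "\<And>h x. \<bar>frechet_derivative w (at x) h\<bar> \<le> C h"
      by metis
    \<comment> \<open>All the \<open>W n\<close> obey the directional bounds \<open>C\<close> of
      \<open>w\<close>, so a constant times the norm of \<tau>, which is integrable,
      dominates.\<close>
    have "(\<lambda>n. ?L (W n)) \<longlonglongrightarrow> ?L w"
    proof (rule integral_dominated_convergence)
      show "integrable \<mu> (\<lambda>x. (\<Sum>i\<in>Basis. C i) * norm (\<tau> x))"
        using \<tau> by simp
      show "AE x in \<mu>. (\<lambda>n. frechet_derivative (W n) (at x) (\<tau> x)) \<longlonglongrightarrow> frechet_derivative w (at x) (\<tau> x)"
        using W(4) by simp
      show "AE x in \<mu>. norm (frechet_derivative (W n) (at x) (\<tau> x)) \<le> (\<Sum>i\<in>Basis. C i) * norm (\<tau> x)" for n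
        using abs_derivative_le_of_basis[OF WC] W(3)[OF C] by simp
    qed (use C1_c_derivative_measurable[OF _ sets borel_measurable_integrable[OF \<tau>]] w WC in auto)
    then show ?thesis
      by (rule LIMSEQ_le_const2) (use smooth[OF W(1) \<open>0 < B\<close> W(2)] in auto)
  qed
  then show thesis using that by blast
qed

section \<open>Closability in L1\<close>

lemma box_bump_in_C1_c: "box_bump a b \<in> C1_c"
  unfolding C1_c_def using C_k_box_bump compactly_supported_box_bump by blast

lemma integrable_bounded_continuous_mult:
  fixes z :: "'a::euclidean_space \<Rightarrow> real"
  assumes "sets \<mu> = sets borel" "integrable \<mu> z" "continuous_on UNIV f" "\<And>x. \<bar>f x\<bar> \<le> B"
  shows "integrable \<mu> (\<lambda>x. f x * z x)"
proof (rule Bochner_Integration.integrable_bound)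
  have "f \<in> borel_measurable \<mu>"
    using borel_measurable_continuous_onI[OF assms(3)] measurable_cong_sets[OF assms(1) refl] by blast
  then show "(\<lambda>x. f x * z x) \<in> borel_measurable \<mu>"
    using assms(2) by measurable
  show "integrable \<mu> (\<lambda>x. B * \<bar>z x\<bar>)"
    using assms(2) by simp
  have "0 \<le> B"
    using assms(4) abs_ge_zero order_trans by blast
  then show "AE x in \<mu>. norm (f x * z x) \<le> norm (B * \<bar>z x\<bar>)"
    using assms(4) by (auto simp: abs_mult intro!: mult_right_mono)
qed

text \<open>The measures with densities the positive and negative parts of \<open>z\<close> are
  finite and agree on boxes, an intersection-stable generator of the Borel sets, so they coincide;
  as they live on disjoint sets, both are zero.\<close>

lemma AE_zero_of_set_integral_box_zero:
  fixes z :: "'a::euclidean_space \<Rightarrow> real"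
  assumes sets: "sets \<mu> = sets borel" and z: "integrable \<mu> z"
    and box: "\<And>a b. (\<integral>x. indicator (box a b) x * z x \<partial>\<mu>) = 0"
  shows "AE x in \<mu>. z x = 0"
proof -
  note [measurable_cong] = sets
  have [measurable]: "z \<in> borel_measurable \<mu>"
    using z by blast
  \<comment> \<open>\<open>ennreal\<close> sends negative reals to 0, so the densities are the
    positive and negative parts of \<open>z\<close>.\<close>
  define P Q where "P = density \<mu> (\<lambda>x. ennreal (z x))" and "Q = density \<mu> (\<lambda>x. ennreal (- z x))"
  have space: "space \<mu> = UNIV"
    using sets_eq_imp_space_eq[OF sets] by simp
  have emeasure_P: "emeasure P A = ennreal (\<integral>x. indicator A x * max 0 (z x) \<partial>\<mu>)"
    and emeasure_Q: "emeasure Q A = ennreal (\<integral>x. indicator A x * max 0 (- z x) \<partial>\<mu>)"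
    if [measurable]: "A \<in> sets borel" for A
  proof -
    have int: "integrable \<mu> (\<lambda>x. indicator A x * max 0 (z x))" "integrable \<mu> (\<lambda>x. indicator A x * max 0 (- z x))"
      using z integrable_mult_indicator[of A \<mu> "\<lambda>x. max 0 (z x)"]
        integrable_mult_indicator[of A \<mu> "\<lambda>x. max 0 (- z x)"] by (simp_all add: sets)
    have "emeasure P A = (\<integral>\<^sup>+x. ennreal (indicator A x * max 0 (z x)) \<partial>\<mu>)"
      unfolding P_def by (subst emeasure_density)
        (auto intro!: nn_integral_cong simp: sets indicator_def ennreal_neg max_def)
    then show "emeasure P A = ennreal (\<integral>x. indicator A x * max 0 (z x) \<partial>\<mu>)"
      using nn_integral_eq_integral[OF int(1)] by simp
    have "emeasure Q A = (\<integral>\<^sup>+x. ennreal (indicator A x * max 0 (- z x)) \<partial>\<mu>)"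
      unfolding Q_def by (subst emeasure_density)
        (auto intro!: nn_integral_cong simp: sets indicator_def ennreal_neg max_def)
    then show "emeasure Q A = ennreal (\<integral>x. indicator A x * max 0 (- z x) \<partial>\<mu>)"
      using nn_integral_eq_integral[OF int(2)] by simp
  qed
  have "P = Q"
  proof (rule measure_eqI_generator_eq)
    let ?E = "range (\<lambda>(a, b). box a b :: 'a set)"
    show "Int_stable ?E"
      by (auto simp: Int_stable_def box_Int_box)
    show "?E \<subseteq> Pow UNIV" by simp
    show "sets P = sigma_sets UNIV ?E" "sets Q = sigma_sets UNIV ?E"
      by (simp_all add: P_def Q_def sets borel_eq_box)
    show "range (\<lambda>n::nat. box (- (real n *\<^sub>R One)) (real n *\<^sub>R One)) \<subseteq> ?E"
      by auto
    show "(\<Union>n::nat. box (- (real n *\<^sub>R One)) (real n *\<^sub>R One)) = (UNIV :: 'a set)"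
      by (rule UN_box_eq_UNIV)
    show "emeasure P (box (- (real n *\<^sub>R One)) (real n *\<^sub>R One)) \<noteq> \<infinity>" for n
      by (simp add: emeasure_P)
    fix X assume "X \<in> ?E"
    then obtain a b where X: "X = box a b" by auto
    have int: "integrable \<mu> (\<lambda>x. indicator X x * max 0 (z x))" "integrable \<mu> (\<lambda>x. indicator X x * max 0 (- z x))"
      using z integrable_mult_indicator[of X \<mu> "\<lambda>x. max 0 (z x)"]
        integrable_mult_indicator[of X \<mu> "\<lambda>x. max 0 (- z x)"] by (simp_all add: sets X)
    have "(\<integral>x. indicator X x * max 0 (z x) \<partial>\<mu>) - (\<integral>x. indicator X x * max 0 (- z x) \<partial>\<mu>)
        = (\<integral>x. indicator X x * z x \<partial>\<mu>)"
      unfolding Bochner_Integration.integral_diff[OF int, symmetric]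
      by (intro Bochner_Integration.integral_cong) (auto simp: max_def algebra_simps)
    then show "emeasure P X = emeasure Q X"
      using box[of a b] by (simp add: emeasure_P emeasure_Q X)
  qed
  \<comment> \<open>\<open>Q\<close> does not charge \<open>?A\<close> and \<open>P\<close> does not
    charge \<open>?B\<close>; since \<open>P = Q\<close>, each measure is null also where its own
    density is positive.\<close>
  let ?A = "{x \<in> space \<mu>. z x > 0}" and ?B = "{x \<in> space \<mu>. z x < 0}"
  have [measurable]: "?A \<in> sets \<mu>" "?B \<in> sets \<mu>"
    by measurable
  have "emeasure Q ?A = 0" "emeasure P ?B = 0"
    unfolding P_def Q_def
    by (auto simp: emeasure_density nn_integral_0_iff_AE ennreal_neg indicator_def)
  then have "emeasure P ?A = 0" "emeasure Q ?B = 0"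
    using \<open>P = Q\<close> by auto
  then have "AE x in \<mu>. ennreal (z x) * indicator ?A x = 0" "AE x in \<mu>. ennreal (- z x) * indicator ?B x = 0"
    unfolding P_def Q_def
    by (auto simp: emeasure_density nn_integral_0_iff_AE)
  then show ?thesis
    by eventually_elim (auto simp: indicator_def space ennreal_eq_0_iff split: if_splits)
qed

text \<open>Indicators of boxes are pointwise limits of the functions 1 - exp(-n b), b the bump of
  the box: they lie in \<open>C1_c\<close>, are bounded by 1 and vanish off the box.\<close>

lemma AE_zero_of_C1_c_integral_zero:
  fixes z :: "'a::euclidean_space \<Rightarrow> real"
  assumes sets: "sets \<mu> = sets borel" and z: "integrable \<mu> z"
    and C1: "\<And>\<phi>. \<phi> \<in> C1_c \<Longrightarrow> (\<integral>x. \<phi> x * z x \<partial>\<mu>) = 0"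
  shows "AE x in \<mu>. z x = 0"
proof (rule AE_zero_of_set_integral_box_zero[OF sets z])
  fix a b :: 'a
  note [measurable_cong] = sets
  have [measurable]: "z \<in> borel_measurable \<mu>"
    using z by blast
  define \<phi> where "\<phi> n x = 1 - exp (- (real n * box_bump a b x))" for n x
  have \<phi>: "\<phi> n \<in> C1_c" for n
    unfolding \<phi>_def
    by (rule C1_c_compose_real[where F="\<lambda>t. 1 - exp (- (real n * t))"
          and F'="\<lambda>t. real n * exp (- (real n * t))" and u="box_bump a b"])
      (auto intro!: derivative_eq_intros continuous_intros box_bump_in_C1_c)
  have [measurable]: "\<phi> n \<in> borel_measurable borel" for n
    by (intro borel_measurable_continuous_onI C1_c_continuous \<phi>)
  have lim: "(\<lambda>n. \<phi> n x) \<longlonglongrightarrow> indicator (box a b) x" for x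
  proof (cases "x \<in> box a b")
    case True
    then have "(\<lambda>n. exp (- box_bump a b x) ^ n) \<longlonglongrightarrow> 0"
      by (intro LIMSEQ_realpow_zero) (auto simp: box_bump_pos_iff)
    then have "(\<lambda>n. 1 - exp (- box_bump a b x) ^ n) \<longlonglongrightarrow> 1 - 0"
      by (intro tendsto_diff tendsto_const)
    moreover have "\<phi> n x = 1 - exp (- box_bump a b x) ^ n" for n
      by (simp add: \<phi>_def exp_of_nat_mult[symmetric])
    ultimately show ?thesis
      using True by (simp only: indicator_simps diff_zero)
  next
    case False
    then show ?thesis by (simp add: \<phi>_def box_bump_eq_0)
  qed
  have "(\<lambda>n. \<integral>x. \<phi> n x * z x \<partial>\<mu>) \<longlonglongrightarrow> (\<integral>x. indicator (box a b) x * z x \<partial>\<mu>)"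
  proof (rule integral_dominated_convergence)
    show "integrable \<mu> (\<lambda>x. \<bar>z x\<bar>)"
      using z by simp
    show "AE x in \<mu>. (\<lambda>n. \<phi> n x * z x) \<longlonglongrightarrow> indicator (box a b) x * z x"
      by (intro AE_I2 tendsto_mult lim tendsto_const)
    have "\<bar>\<phi> n x\<bar> \<le> 1" for n x
      using box_bump_nonneg[of a b x] by (simp add: \<phi>_def)
    then show "AE x in \<mu>. norm (\<phi> n x * z x) \<le> \<bar>z x\<bar>" for n
      by (auto simp: abs_mult intro!: AE_I2 mult_left_le_one_le)
  qed measurable
  then show "(\<integral>x. indicator (box a b) x * z x \<partial>\<mu>) = 0"
    by (simp add: C1[OF \<phi>] LIMSEQ_const_iff)
qed

section \<open>The sine truncation argument\<close>

text \<open>Convergence of \<open>d n\<close> is asked only with the weight of the norm of \<tau>,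
  as this is what Hoelder's inequality extracts from \<alpha> v in the dual exponent of q.\<close>

lemma L1_closability:
  fixes \<tau> :: "'a::euclidean_space \<Rightarrow> 'a" and z :: "'a \<Rightarrow> real"
  assumes fin: "mass (boundary (vector_measure_current \<tau> \<mu>)) < \<infinity>"
    and sets: "sets \<mu> = sets borel" and \<tau>: "integrable \<mu> \<tau>" and z: "integrable \<mu> z"
    and d: "\<And>n. d n \<in> C1_c"
    and lim_d: "(\<lambda>n. \<integral>x. \<bar>d n x\<bar> * norm (\<tau> x) \<partial>\<mu>) \<longlonglongrightarrow> 0"
    and lim_Dd: "(\<lambda>n. \<integral>x. \<bar>frechet_derivative (d n) (at x) (\<tau> x) - z x\<bar> \<partial>\<mu>) \<longlonglongrightarrow> 0"
  shows "AE x in \<mu>. z x = 0"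
proof (rule AE_zero_of_C1_c_integral_zero[OF sets z])
  note [measurable_cong] = sets
  have [measurable]: "z \<in> borel_measurable \<mu>" "\<tau> \<in> borel_measurable \<mu>"
    using z \<tau> by auto
  have [measurable]: "w \<in> borel_measurable borel" if "w \<in> C1_c" for w :: "'a \<Rightarrow> real"
    by (intro borel_measurable_continuous_onI C1_c_continuous that)
  let ?D = "\<lambda>w x. frechet_derivative w (at x) (\<tau> x)"
  have D_int: "integrable \<mu> (?D w)" if "w \<in> C1_c" for w
    using C1_c_derivative_integrable[OF that sets \<tau>] .
  have d_int: "integrable \<mu> (\<lambda>x. \<bar>d n x\<bar> * norm (\<tau> x))" for n
  proof -
    obtain B where "\<And>x. \<bar>d n x\<bar> \<le> B"
      using C1_c_bounded[OF d] by metis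
    then show ?thesis
      by (intro integrable_bounded_continuous_mult[OF sets, where B=B] continuous_intros C1_c_continuous[OF d]) (auto simp: \<tau>)
  qed
  have Dd_int: "integrable \<mu> (\<lambda>x. \<bar>?D (d n) x - z x\<bar>)" for n
    using D_int[OF d] z by auto
  obtain M where M: "\<And>w B. w \<in> C1_c \<Longrightarrow> 0 < B \<Longrightarrow> (\<And>x. \<bar>w x\<bar> \<le> B) \<Longrightarrow> (\<integral>x. ?D w x \<partial>\<mu>) \<le> M * B"
    using boundary_mass_bound[OF fin sets \<tau>] by metis
  \<comment> \<open>Both errors are nonnegative, so adding them gives one subsequence along which
    both tend to 0 almost everywhere.\<close>
  obtain r where r: "strict_mono r"
    "AE x in \<mu>. (\<lambda>n. \<bar>d (r n) x\<bar> * norm (\<tau> x) + \<bar>?D (d (r n)) x - z x\<bar>) \<longlonglongrightarrow> 0"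
  proof -
    have "(\<lambda>n. (\<integral>x. \<bar>d n x\<bar> * norm (\<tau> x) \<partial>\<mu>) + (\<integral>x. \<bar>?D (d n) x - z x\<bar> \<partial>\<mu>)) \<longlonglongrightarrow> 0 + 0"
      by (intro tendsto_add lim_d lim_Dd)
    then have "(\<lambda>n. \<integral>x. norm (\<bar>d n x\<bar> * norm (\<tau> x) + \<bar>?D (d n) x - z x\<bar>) \<partial>\<mu>) \<longlonglongrightarrow> 0"
      by (simp add: Bochner_Integration.integral_add[OF d_int Dd_int])
    then show thesis
      using tendsto_L1_AE_subseq[of \<mu> "\<lambda>n x. \<bar>d n x\<bar> * norm (\<tau> x) + \<bar>?D (d n) x - z x\<bar>"]
        Bochner_Integration.integrable_add[OF d_int Dd_int] that by blast
  qed
  have lim_cos: "AE x in \<mu>. (\<lambda>n. \<bar>cos (d (r n) x / e) - 1\<bar> * \<bar>z x\<bar>) \<longlonglongrightarrow> 0" for e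
    using r(2)
  proof eventually_elim
    fix x assume *: "(\<lambda>n. \<bar>d (r n) x\<bar> * norm (\<tau> x) + \<bar>?D (d (r n)) x - z x\<bar>) \<longlonglongrightarrow> 0"
    have 1: "(\<lambda>n. \<bar>d (r n) x\<bar> * norm (\<tau> x)) \<longlonglongrightarrow> 0"
      by (rule tendsto_sandwich[OF _ _ tendsto_const *]) (auto intro!: always_eventually)
    have 2: "(\<lambda>n. \<bar>?D (d (r n)) x - z x\<bar>) \<longlonglongrightarrow> 0"
      by (rule tendsto_sandwich[OF _ _ tendsto_const *]) (auto intro!: always_eventually)
    show "(\<lambda>n. \<bar>cos (d (r n) x / e) - 1\<bar> * \<bar>z x\<bar>) \<longlonglongrightarrow> 0"
    proof (cases "\<tau> x = 0") \<comment> \<open>\<open>d\<^sub>n\<close> need not converge where \<open>\<tau>\<close> vanishes, but \<open>z\<close> is zero there.\<close>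
      case True
      then have "?D (d (r n)) x = 0" for n
        using linear_0[OF has_derivative_linear[OF C1_c_has_derivative[OF d]]] by simp
      with 2 have "z x = 0"
        by (simp add: LIMSEQ_const_iff)
      then show ?thesis by simp
    next
      case False
      from tendsto_mult_right[OF 1, of "inverse (norm (\<tau> x))"] False
      have "(\<lambda>n. \<bar>d (r n) x\<bar>) \<longlonglongrightarrow> 0"
        by (simp add: field_simps)
      then have "(\<lambda>n. d (r n) x) \<longlonglongrightarrow> 0"
        by (rule tendsto_rabs_zero_cancel)
      then have "(\<lambda>n. \<bar>cos (d (r n) x * inverse e) - 1\<bar> * \<bar>z x\<bar>) \<longlonglongrightarrow> \<bar>cos (0 * inverse e) - 1\<bar> * \<bar>z x\<bar>"
        by (intro tendsto_intros)
      then show ?thesis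
        by (simp add: divide_inverse)
    qed
  qed
  have le: "(\<integral>x. \<phi> x * z x \<partial>\<mu>) \<le> 0" if \<phi>: "\<phi> \<in> C1_c" for \<phi>
  proof -
    obtain C where C: "0 < C" "\<And>x. \<bar>\<phi> x\<bar> \<le> C"
      using C1_c_bounded[OF \<phi>] by metis
    obtain C' where C': "0 < C'" "\<And>x h. \<bar>frechet_derivative \<phi> (at x) h\<bar> \<le> C' * norm h"
      using C1_c_derivative_bounded_norm[OF \<phi>] by metis
    have \<phi>z_int: "integrable \<mu> (\<lambda>x. \<phi> x * z x)"
      using integrable_bounded_continuous_mult[OF sets z C1_c_continuous[OF \<phi>] C(2)] .
    have "(\<integral>x. \<phi> x * z x \<partial>\<mu>) \<le> M * (C * e)" if e: "0 < e" for e
    proof -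
      \<comment> \<open>\<open>s n\<close> is bounded by \<open>e\<close>, is dominated by
        \<open>d (r n)\<close> in absolute value, and its derivative is that of
        \<open>d (r n)\<close> times a cosine.\<close>
      define s where "s n x = e * sin (d (r n) x / e)" for n x
      have s: "s n \<in> C1_c" for n
        unfolding s_def
        by (rule C1_c_compose_real[where F="\<lambda>t. e * sin (t / e)" and F'="\<lambda>t. cos (t / e)" and u="d (r n)"])
          (use e in \<open>auto intro!: derivative_eq_intros continuous_intros d\<close>)
      have Ds: "(s n has_derivative (\<lambda>h. cos (d (r n) x / e) * frechet_derivative (d (r n)) (at x) h)) (at x)" for n x
        unfolding s_def
        by (rule C_k_1_compose_real(2)[where F="\<lambda>t. e * sin (t / e)" and F'="\<lambda>t. cos (t / e)" and u="d (r n)"])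
          (use e d in \<open>auto intro!: derivative_eq_intros continuous_intros simp: C1_c_def\<close>)
      have \<phi>s: "(\<lambda>x. \<phi> x * s n x) \<in> C1_c" for n
        using C1_c_mult[OF _ s] \<phi> unfolding C1_c_def by blast
      have D\<phi>s: "?D (\<lambda>x. \<phi> x * s n x) x = \<phi> x * (cos (d (r n) x / e) * ?D (d (r n)) x) + ?D \<phi> x * s n x" for n x
        using frechet_derivative_at[OF has_derivative_mult[OF C1_c_has_derivative[OF \<phi>] Ds], symmetric] by simp
      \<comment> \<open>Three errors: the derivative falling on \<phi>, the L1 distance of the
        derivative of \<open>d (r n)\<close> to \<open>z\<close>, and the deviation of the cosine
        from 1.\<close>
      define R where "R n x = C' * (\<bar>d (r n) x\<bar> * norm (\<tau> x)) + C * \<bar>?D (d (r n)) x - z x\<bar>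
          + C * (\<bar>cos (d (r n) x / e) - 1\<bar> * \<bar>z x\<bar>)" for n x
      have cos_int: "integrable \<mu> (\<lambda>x. \<bar>cos (d (r n) x / e) - 1\<bar> * \<bar>z x\<bar>)" for n
        by (rule integrable_bounded_continuous_mult[OF sets, where B=2])
          (use z e in \<open>auto intro!: continuous_intros C1_c_continuous[OF d] order_trans[OF abs_triangle_ineq4]
            simp: abs_le_iff intro: order_trans[OF abs_cos_le_one]\<close>)
      have R: "\<bar>?D (\<lambda>x. \<phi> x * s n x) x - \<phi> x * z x\<bar> \<le> R n x" for n x
      proof -
        have "?D (\<lambda>x. \<phi> x * s n x) x - \<phi> x * z x = ?D \<phi> x * s n x
            + \<phi> x * (cos (d (r n) x / e) * (?D (d (r n)) x - z x)) + \<phi> x * ((cos (d (r n) x / e) - 1) * z x)"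
          unfolding D\<phi>s by (simp add: algebra_simps)
        moreover have "\<bar>?D \<phi> x * s n x\<bar> \<le> C' * norm (\<tau> x) * \<bar>d (r n) x\<bar>"
          unfolding abs_mult
        proof (intro mult_mono C')
          show "\<bar>s n x\<bar> \<le> \<bar>d (r n) x\<bar>"
            using abs_sin_x_le_abs_x[of "d (r n) x / e"] e by (simp add: s_def abs_mult field_simps)
        qed (use C' in auto)
        moreover have "\<bar>\<phi> x * (cos (d (r n) x / e) * (?D (d (r n)) x - z x))\<bar> \<le> C * (1 * \<bar>?D (d (r n)) x - z x\<bar>)"
          unfolding abs_mult by (intro mult_mono C) (use C in auto)
        moreover have "\<bar>\<phi> x * ((cos (d (r n) x / e) - 1) * z x)\<bar> \<le> C * (\<bar>cos (d (r n) x / e) - 1\<bar> * \<bar>z x\<bar>)"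
          unfolding abs_mult by (intro mult_mono C) (use C in auto)
        moreover have "C' * norm (\<tau> x) * \<bar>d (r n) x\<bar> = C' * (\<bar>d (r n) x\<bar> * norm (\<tau> x))"
          by simp
        ultimately show ?thesis
          unfolding R_def by linarith
      qed
      have "\<phi> x * z x \<le> ?D (\<lambda>x. \<phi> x * s n x) x + R n x" for n x
        using R[of n x] by linarith
      moreover have R_int: "integrable \<mu> (R n)" for n
        unfolding R_def by (intro Bochner_Integration.integrable_add integrable_mult_right d_int Dd_int cos_int)
      ultimately have "(\<integral>x. \<phi> x * z x \<partial>\<mu>) \<le> (\<integral>x. ?D (\<lambda>x. \<phi> x * s n x) x + R n x \<partial>\<mu>)" for n
        by (intro integral_mono \<phi>z_int Bochner_Integration.integrable_add D_int[OF \<phi>s])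
      moreover have "(\<integral>x. ?D (\<lambda>x. \<phi> x * s n x) x + R n x \<partial>\<mu>) \<le> M * (C * e) + (\<integral>x. R n x \<partial>\<mu>)" for n
      proof -
        \<comment> \<open>The finite mass of the boundary enters here: it sees only the sup norm of
          \<open>\<phi> * s n\<close>, at most \<open>C * e\<close> for every
          \<open>n\<close>.\<close>
        have "\<bar>\<phi> x * s n x\<bar> \<le> C * e" for x
          unfolding abs_mult by (intro mult_mono C) (use C e in \<open>auto simp: s_def abs_mult\<close>)
        then have "(\<integral>x. ?D (\<lambda>x. \<phi> x * s n x) x \<partial>\<mu>) \<le> M * (C * e)"
          by (intro M \<phi>s) (use C e in auto)
        then show ?thesis
          using D_int[OF \<phi>s, of n] R_int by simp
      qed
      ultimately have le: "(\<integral>x. \<phi> x * z x \<partial>\<mu>) \<le> M * (C * e) + (\<integral>x. R n x \<partial>\<mu>)" for n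
        by (rule order_trans)
      have "(\<lambda>n. M * (C * e) + (\<integral>x. R n x \<partial>\<mu>)) \<longlonglongrightarrow> M * (C * e) + 0"
      proof (intro tendsto_add tendsto_const)
        \<comment> \<open>The other two errors tend to 0 by hypothesis; this one does by
          \<open>lim_cos\<close> and domination by twice the absolute value of
          \<open>z\<close>.\<close>
        have "(\<lambda>n. \<integral>x. \<bar>cos (d (r n) x / e) - 1\<bar> * \<bar>z x\<bar> \<partial>\<mu>) \<longlonglongrightarrow> (\<integral>x. 0 \<partial>\<mu>)"
        proof (rule integral_dominated_convergence)
          show "integrable \<mu> (\<lambda>x. 2 * \<bar>z x\<bar>)"
            using z by simp
          have "\<bar>cos t - 1\<bar> \<le> 2" for t :: real
            using cos_ge_minus_one[of t] cos_le_one[of t] by linarith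
          then show "AE x in \<mu>. norm (\<bar>cos (d (r n) x / e) - 1\<bar> * \<bar>z x\<bar>) \<le> 2 * \<bar>z x\<bar>" for n
            by (auto intro!: AE_I2 mult_right_mono simp: abs_mult)
        qed (use lim_cos cos_int in auto)
        then have "(\<lambda>n. C' * (\<integral>x. \<bar>d (r n) x\<bar> * norm (\<tau> x) \<partial>\<mu>) + C * (\<integral>x. \<bar>?D (d (r n)) x - z x\<bar> \<partial>\<mu>)
            + C * (\<integral>x. \<bar>cos (d (r n) x / e) - 1\<bar> * \<bar>z x\<bar> \<partial>\<mu>)) \<longlonglongrightarrow> C' * 0 + C * 0 + C * 0"
          using LIMSEQ_subseq_LIMSEQ[OF lim_d r(1)] LIMSEQ_subseq_LIMSEQ[OF lim_Dd r(1)]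
          by (intro tendsto_intros) (auto simp: o_def)
        then show "(\<lambda>n. \<integral>x. R n x \<partial>\<mu>) \<longlonglongrightarrow> 0"
          using d_int Dd_int cos_int by (simp add: R_def)
      qed
      from LIMSEQ_le_const[OF this] le show ?thesis
        by auto
    qed
    then have "(\<integral>x. \<phi> x * z x \<partial>\<mu>) \<le> M * (C * e)" if "0 < e" for e
      using that by blast
    \<comment> \<open>\<open>M\<close> and \<open>C\<close> do not depend on \<open>e\<close>, so
      the bound vanishes as \<open>e\<close> tends to 0 from the right.\<close>
    moreover have "((\<lambda>e. M * (C * e)) \<longlongrightarrow> M * (C * 0)) (at_right 0)"
      by (intro tendsto_intros)
    ultimately show ?thesis
      by (intro tendsto_lowerbound[where F="at_right (0::real)" and f="\<lambda>e. M * (C * e)"])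
        (auto simp: eventually_at_filter intro!: always_eventually)
  qed
  fix \<phi> :: "'a \<Rightarrow> real" assume \<phi>: "\<phi> \<in> C1_c"
  \<comment> \<open>Testing with the negative of \<phi> gives the reverse inequality.\<close>
  have "(\<lambda>x. (- 1) * \<phi> x) \<in> C1_c"
    by (rule C1_c_mult[OF C_k_const \<phi>])
  from le[OF this] le[OF \<phi>] show "(\<integral>x. \<phi> x * z x \<partial>\<mu>) = 0"
    by simp
qed

section \<open>Hoelder's inequality\<close>

lemma Lp_norm_1: "Lp_norm 1 \<mu> f = (\<integral>\<^sup>+x. ennreal (norm (f x)) \<partial>\<mu>)"
  by (simp add: Lp_norm_def Let_def less_top)

lemma nn_integral_mult_le_esssup:
  fixes f :: "'a \<Rightarrow> 'b::real_normed_vector" and g :: "'a \<Rightarrow> 'c::real_normed_vector"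
  assumes "g \<in> borel_measurable \<mu>"
  shows "(\<integral>\<^sup>+x. ennreal (norm (f x)) * ennreal (norm (g x)) \<partial>\<mu>) \<le> Lp_norm \<infinity> \<mu> f * Lp_norm 1 \<mu> g"
proof -
  have "(\<integral>\<^sup>+x. ennreal (norm (f x)) * ennreal (norm (g x)) \<partial>\<mu>)
      \<le> (\<integral>\<^sup>+x. Lp_norm \<infinity> \<mu> f * ennreal (norm (g x)) \<partial>\<mu>)"
    using esssup_AE[of "\<lambda>x. ennreal (norm (f x))" \<mu>]
    by (intro nn_integral_mono_AE) (auto simp: Lp_norm_def elim!: eventually_mono intro: mult_right_mono)
  then show ?thesis
    using assms by (simp add: Lp_norm_1 nn_integral_cmult)
qed

text \<open>Finiteness of the norm rules out the branch with an infinite integral; raising to the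
  power \<open>P\<close> then undoes the root in \<open>Lp_norm\<close>.\<close>

lemma nn_integral_powr_eq_Lp_norm_powr:
  assumes P: "0 < P" and fin: "Lp_norm (ennreal P) \<mu> f = ennreal A" "0 \<le> A"
  shows "(\<integral>\<^sup>+x. ennreal (norm (f x) powr P) \<partial>\<mu>) = ennreal (A powr P)"
proof -
  let ?I = "\<integral>\<^sup>+x. ennreal (norm (f x) powr P) \<partial>\<mu>"
  have "(if ?I = \<infinity> then \<infinity> else ennreal (enn2real ?I powr (1 / P))) = ennreal A"
    using P fin(1) unfolding Lp_norm_def Let_def
    by (simp only: ennreal_neq_top infinity_ennreal_def if_False enn2real_ennreal less_imp_le)
  then have I: "?I \<noteq> \<infinity>" "enn2real ?I powr (1 / P) = A"
    using fin(2) by (auto split: if_splits)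
  then have "A powr P = enn2real ?I"
    using P by (simp add: powr_powr flip: I(2))
  then show ?thesis
    using I(1) by (simp add: less_top)
qed

lemma Lp_norm_eq_0_imp_AE:
  assumes P: "0 < P" and [measurable]: "f \<in> borel_measurable \<mu>" and 0: "Lp_norm (ennreal P) \<mu> f = 0"
  shows "AE x in \<mu>. f x = 0"
proof -
  have "(\<integral>\<^sup>+x. ennreal (norm (f x) powr P) \<partial>\<mu>) = 0"
    using nn_integral_powr_eq_Lp_norm_powr[OF P, of \<mu> f 0] 0 by simp
  then have "AE x in \<mu>. ennreal (norm (f x) powr P) = 0"
    by (subst (asm) nn_integral_0_iff_AE) auto
  then show ?thesis
    by eventually_elim (auto simp: ennreal_eq_0_iff)
qed

lemma Hoelder_inequality_finite:
  fixes f :: "'a \<Rightarrow> 'b::real_normed_vector" and g :: "'a \<Rightarrow> 'c::real_normed_vector"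
  assumes P: "1 < P" and Q: "1 < Q" and PQ: "1 / P + 1 / Q = 1"
    and f[measurable]: "f \<in> borel_measurable \<mu>" and g[measurable]: "g \<in> borel_measurable \<mu>"
  shows "(\<integral>\<^sup>+x. ennreal (norm (f x)) * ennreal (norm (g x)) \<partial>\<mu>)
    \<le> Lp_norm (ennreal P) \<mu> f * Lp_norm (ennreal Q) \<mu> g"
\<comment> \<open>Zero norms come first: the functions are later divided by their norms, and
  \<open>ennreal\<close> has 0 times infinity equal to 0, so an infinite norm makes the claim
  trivial only when the other norm is nonzero.\<close>
proof (cases "Lp_norm (ennreal P) \<mu> f = 0 \<or> Lp_norm (ennreal Q) \<mu> g = 0")
  case True
  then have "(AE x in \<mu>. f x = 0) \<or> (AE x in \<mu>. g x = 0)"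
    using Lp_norm_eq_0_imp_AE[OF _ f] Lp_norm_eq_0_imp_AE[OF _ g] P Q by fastforce
  then have "AE x in \<mu>. ennreal (norm (f x)) * ennreal (norm (g x)) = 0"
    by (auto elim!: eventually_mono)
  then have "(\<integral>\<^sup>+x. ennreal (norm (f x)) * ennreal (norm (g x)) \<partial>\<mu>) = 0"
    by (subst nn_integral_0_iff_AE) auto
  then show ?thesis by simp
next
  case False
  show ?thesis
  proof (cases "Lp_norm (ennreal P) \<mu> f = \<infinity> \<or> Lp_norm (ennreal Q) \<mu> g = \<infinity>")
    case True
    with False show ?thesis by (auto simp: ennreal_mult_eq_top_iff top_unique)
  next
    case fin: False
    then obtain A B where A: "Lp_norm (ennreal P) \<mu> f = ennreal A" "0 \<le> A"
      and B: "Lp_norm (ennreal Q) \<mu> g = ennreal B" "0 \<le> B"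
      by (metis ennreal_cases infinity_ennreal_def)
    with False have pos: "0 < A" "0 < B"
      by (auto simp: less_le)
    \<comment> \<open>Young's inequality for the normalised functions, multiplied back by
      \<open>A * B\<close>; after integration the powers of \<open>A\<close> and \<open>B\<close>
      cancel and leave 1/P + 1/Q = 1.\<close>
    have "ennreal (norm (f x)) * ennreal (norm (g x)) \<le>
        ennreal (A * B) * (ennreal (1 / (P * A powr P)) * ennreal (norm (f x) powr P)
          + ennreal (1 / (Q * B powr Q)) * ennreal (norm (g x) powr Q))" for x
    proof -
      have "norm (f x) / A * (norm (g x) / B)
          \<le> (norm (f x) / A) powr P / P + (norm (g x) / B) powr Q / Q"
        using pos by (intro Youngs_inequality P Q PQ) auto
      then have "norm (f x) * norm (g x) \<le> (A * B) * ((norm (f x) / A) powr P / P + (norm (g x) / B) powr Q / Q)"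
        using pos by (simp add: field_simps)
      also have "\<dots> = (A * B) * (1 / (P * A powr P) * norm (f x) powr P + 1 / (Q * B powr Q) * norm (g x) powr Q)"
        using pos by (simp add: powr_divide mult.commute)
      finally show ?thesis
        using pos P Q by (simp flip: ennreal_mult ennreal_plus add: ennreal_leI)
    qed
    then have "(\<integral>\<^sup>+x. ennreal (norm (f x)) * ennreal (norm (g x)) \<partial>\<mu>) \<le>
        (\<integral>\<^sup>+x. ennreal (A * B) * (ennreal (1 / (P * A powr P)) * ennreal (norm (f x) powr P)
          + ennreal (1 / (Q * B powr Q)) * ennreal (norm (g x) powr Q)) \<partial>\<mu>)"
      by (intro nn_integral_mono)
    also have "\<dots> = ennreal (A * B) * (ennreal (1 / (P * A powr P)) * ennreal (A powr P)
        + ennreal (1 / (Q * B powr Q)) * ennreal (B powr Q))"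
      using nn_integral_powr_eq_Lp_norm_powr[OF _ A] nn_integral_powr_eq_Lp_norm_powr[OF _ B] P Q
      by (simp add: nn_integral_cmult nn_integral_add)
    also have "\<dots> = ennreal (A * B) * ennreal (1 / P + 1 / Q)"
      using pos P Q by (simp flip: ennreal_mult ennreal_plus)
    finally show ?thesis
      using A B by (simp add: PQ ennreal_mult)
  qed
qed

lemma ennreal_one_divide_eq_one: "1 / p = 1 \<Longrightarrow> p = 1" for p :: ennreal
proof (cases p)
  case (real r)
  assume "1 / p = 1"
  with real show ?thesis
    by (cases "r = 0") (auto simp: divide_ennreal simp flip: ennreal_1)
qed simp

text \<open>In \<open>ennreal\<close> 1/\<infinity> = 0, which produces the two endpoint pairs, and
  1/0 = \<infinity>, which excludes exponent 0. Otherwise both reciprocals are positive with sum 1,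
  so each is below 1.\<close>

lemma conjugate_exponents_cases:
  fixes p p' :: ennreal
  assumes "1 / p + 1 / p' = 1"
  obtains "p = \<infinity>" "p' = 1" | "p = 1" "p' = \<infinity>"
  | P Q where "p = ennreal P" "p' = ennreal Q" "1 < P" "1 < Q" "1 / P + 1 / Q = 1"
proof (cases p)
  case top
  then have "1 / p' = 1" using assms by simp
  then show thesis using top that(1) ennreal_one_divide_eq_one by simp
next
  case (real P)
  show thesis
  proof (cases p')
    case top
    then have "1 / p = 1" using assms by simp
    then show thesis using top that(2) ennreal_one_divide_eq_one by simp
  next
    case Q: (real Q)
    have "1 / p \<noteq> \<infinity>" "1 / p' \<noteq> \<infinity>"
      using assms by (auto simp: top_add)
    then have pos: "0 < P" "0 < Q"
      using real Q by (auto simp: less_le ennreal_divide_eq_top_iff)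
    then have "ennreal (1 / P + 1 / Q) = ennreal 1"
      using assms real(2) Q(2) by (simp add: divide_ennreal flip: ennreal_1)
    then have 1: "1 / P + 1 / Q = 1"
      using pos by (subst (asm) ennreal_inj) auto
    then have "1 / P < 1" "1 / Q < 1"
      using pos by (smt (verit) divide_pos_pos)+
    then show thesis
      using that(3)[OF real(2) Q(2) _ _ 1] pos by (simp add: field_simps)
  qed
qed

lemma Hoelder_inequality:
  fixes f :: "'a \<Rightarrow> 'b::real_normed_vector" and g :: "'a \<Rightarrow> 'c::real_normed_vector"
  assumes "1 / p + 1 / p' = 1" and f: "f \<in> borel_measurable \<mu>" and g: "g \<in> borel_measurable \<mu>"
  shows "(\<integral>\<^sup>+x. ennreal (norm (f x)) * ennreal (norm (g x)) \<partial>\<mu>) \<le> Lp_norm p \<mu> f * Lp_norm p' \<mu> g"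
  using assms(1)
proof (cases rule: conjugate_exponents_cases)
  case 1
  then show ?thesis using nn_integral_mult_le_esssup[OF g] by simp
next
  case 2
  then show ?thesis
    using nn_integral_mult_le_esssup[OF f, of g] by (simp add: mult.commute)
next
  case (3 P Q)
  then show ?thesis using Hoelder_inequality_finite[OF _ _ _ f g] by simp
qed

section \<open>Consequences of Hoelder's inequality for integrability and limits\<close>

lemma integrable_of_conjugate_Lp:
  fixes f :: "'a \<Rightarrow> real" and g :: "'a \<Rightarrow> 'b::{banach, second_countable_topology}"
  assumes conj: "1 / p + 1 / p' = 1" and f: "f \<in> Lp_space p' \<mu>" and g: "g \<in> Lp_space p \<mu>"
  shows "integrable \<mu> (\<lambda>x. f x *\<^sub>R g x)"
proof (rule integrableI_bounded)
  have [measurable]: "f \<in> borel_measurable \<mu>" "g \<in> borel_measurable \<mu>"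
    using f g by (auto simp: Lp_space_def)
  show "(\<lambda>x. f x *\<^sub>R g x) \<in> borel_measurable \<mu>"
    by measurable
  have "(\<integral>\<^sup>+x. ennreal (norm (f x *\<^sub>R g x)) \<partial>\<mu>) = (\<integral>\<^sup>+x. ennreal (norm (g x)) * ennreal (norm (f x)) \<partial>\<mu>)"
    by (intro nn_integral_cong) (simp add: mult.commute flip: ennreal_mult)
  also have "\<dots> \<le> Lp_norm p \<mu> g * Lp_norm p' \<mu> f"
    by (rule Hoelder_inequality[OF conj]) auto
  also have "\<dots> < \<infinity>"
    using f g by (simp add: Lp_space_def ennreal_mult_less_top)
  finally show "(\<integral>\<^sup>+x. ennreal (norm (f x *\<^sub>R g x)) \<partial>\<mu>) < \<infinity>" .
qed

lemma tendsto_nn_integral_mult_zero: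
  fixes a :: "nat \<Rightarrow> 'a \<Rightarrow> 'b::real_normed_vector" and g :: "'a \<Rightarrow> 'c::real_normed_vector"
  assumes conj: "1 / p + 1 / p' = 1" and a: "\<And>n. a n \<in> borel_measurable \<mu>" and g: "g \<in> Lp_space p' \<mu>"
    and lim: "(\<lambda>n. Lp_norm p \<mu> (a n)) \<longlonglongrightarrow> 0"
  shows "(\<lambda>n. \<integral>\<^sup>+x. ennreal (norm (a n x)) * ennreal (norm (g x)) \<partial>\<mu>) \<longlonglongrightarrow> 0"
proof (rule tendsto_sandwich[OF _ _ tendsto_const])
  have "Lp_norm p' \<mu> g < top" and gm: "g \<in> borel_measurable \<mu>"
    using g by (auto simp: Lp_space_def)
  from ennreal_tendsto_cmult[OF this(1) lim]
  show "(\<lambda>n. Lp_norm p \<mu> (a n) * Lp_norm p' \<mu> g) \<longlonglongrightarrow> 0"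
    by (simp add: mult.commute)
  show "\<forall>\<^sub>F n in sequentially. (\<integral>\<^sup>+x. ennreal (norm (a n x)) * ennreal (norm (g x)) \<partial>\<mu>)
      \<le> Lp_norm p \<mu> (a n) * Lp_norm p' \<mu> g"
    by (intro always_eventually allI Hoelder_inequality[OF conj a gm])
qed auto

text \<open>\<open>a\<close> and \<open>b\<close> are the errors of two approximations of the same
  kind; the difference of the approximants is controlled pointwise by the sum of the errors, and
  Hoelder's inequality handles each summand against \<open>g\<close>.\<close>

lemma tendsto_integral_zero_of_Lp_norm:
  fixes X :: "nat \<Rightarrow> 'a \<Rightarrow> real" and a b :: "nat \<Rightarrow> 'a \<Rightarrow> 'b::real_normed_vector" and g :: "'a \<Rightarrow> 'c::real_normed_vector"
  assumes conj: "1 / p + 1 / p' = 1" and g: "g \<in> Lp_space p' \<mu>"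
    and a[measurable]: "\<And>n. a n \<in> borel_measurable \<mu>" and b[measurable]: "\<And>n. b n \<in> borel_measurable \<mu>"
    and lim: "(\<lambda>n. Lp_norm p \<mu> (a n)) \<longlonglongrightarrow> 0" "(\<lambda>n. Lp_norm p \<mu> (b n)) \<longlonglongrightarrow> 0"
    and X: "\<And>n. X n \<in> borel_measurable \<mu>" "\<And>n x. 0 \<le> X n x"
      "\<And>n x. X n x \<le> (norm (a n x) + norm (b n x)) * norm (g x)"
  shows "(\<lambda>n. \<integral>x. X n x \<partial>\<mu>) \<longlonglongrightarrow> 0"
proof -
  have [measurable]: "g \<in> borel_measurable \<mu>"
    using g by (simp add: Lp_space_def)
  have "(\<lambda>n. (\<integral>\<^sup>+x. ennreal (norm (a n x)) * ennreal (norm (g x)) \<partial>\<mu>)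
      + (\<integral>\<^sup>+x. ennreal (norm (b n x)) * ennreal (norm (g x)) \<partial>\<mu>)) \<longlonglongrightarrow> 0 + 0"
    by (intro tendsto_add tendsto_nn_integral_mult_zero[OF conj] a b g lim)
  then have lim': "(\<lambda>n. \<integral>\<^sup>+x. ennreal (norm (a n x)) * ennreal (norm (g x))
      + ennreal (norm (b n x)) * ennreal (norm (g x)) \<partial>\<mu>) \<longlonglongrightarrow> 0"
    by (simp add: nn_integral_add)
  have bound: "ennreal (X n x) \<le> ennreal (norm (a n x)) * ennreal (norm (g x))
      + ennreal (norm (b n x)) * ennreal (norm (g x))" for n x
    using X(3)[of n x] by (simp add: distrib_right ennreal_leI flip: ennreal_mult ennreal_plus)
  have "(\<lambda>n. \<integral>\<^sup>+x. ennreal (X n x) \<partial>\<mu>) \<longlonglongrightarrow> 0"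
    by (rule tendsto_sandwich[OF _ _ tendsto_const lim'])
      (intro always_eventually allI nn_integral_mono bound zero_le)+
  then have "(\<lambda>n. enn2real (\<integral>\<^sup>+x. ennreal (X n x) \<partial>\<mu>)) \<longlonglongrightarrow> enn2real 0"
    by (intro tendsto_enn2real) auto
  then show ?thesis
    using X by (simp add: integral_eq_nn_integral)
qed

section \<open>Closability of the directional derivative\<close>

theorem theorem4p1:
  fixes \<mu> :: "(real ^ 'n) measure"
    and p q p' q' :: ennreal
    and v :: "real ^ 'n \<Rightarrow> real ^ 'n"
  assumes "radon_measure \<mu>"
    and "1 \<le> p" and "1 \<le> q"
    and "1 / p + 1 / p' = 1" and "1 / q + 1 / q' = 1"
    and "v \<in> borel_measurable borel" and "v \<in> Lp_space p \<mu>"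
    and "\<exists>\<alpha> :: real ^ 'n \<Rightarrow> real.
           \<alpha> \<in> borel_measurable borel \<and>
           (AE x in \<mu>. \<alpha> x \<noteq> 0) \<and>
           \<alpha> \<in> Lp_space p' \<mu> \<and>
           (\<lambda>x. \<alpha> x *\<^sub>R v x) \<in> Lp_space q' \<mu> \<and>
           normal_1_current (vector_measure_current (\<lambda>x. \<alpha> x *\<^sub>R v x) \<mu>)"
  shows "closable q p \<mu> C1_c (directional_derivative v)"
  unfolding closable_def
proof (intro ballI impI)
  have sets: "sets \<mu> = sets borel"
    using assms(1) by (simp add: radon_measure_def)
  note [measurable_cong] = sets
  obtain \<alpha> :: "real ^ 'n \<Rightarrow> real" where \<alpha>: "AE x in \<mu>. \<alpha> x \<noteq> 0" "\<alpha> \<in> Lp_space p' \<mu>"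
      "(\<lambda>x. \<alpha> x *\<^sub>R v x) \<in> Lp_space q' \<mu>"
      "normal_1_current (vector_measure_current (\<lambda>x. \<alpha> x *\<^sub>R v x) \<mu>)"
    using assms(8) by blast
  fix f g h
  assume f: "f \<in> Lp_space q \<mu>" and g: "g \<in> Lp_space p \<mu>" and h: "h \<in> Lp_space p \<mu>"
    and "(f, g) \<in> graph_closure q p \<mu> C1_c (directional_derivative v)"
    and "(f, h) \<in> graph_closure q p \<mu> C1_c (directional_derivative v)"
  then obtain u w where u: "\<And>n. u n \<in> C1_c" "(\<lambda>n. Lp_norm q \<mu> (\<lambda>x. u n x - f x)) \<longlonglongrightarrow> 0"
      "(\<lambda>n. Lp_norm p \<mu> (\<lambda>x. directional_derivative v (u n) x - g x)) \<longlonglongrightarrow> 0"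
    and w: "\<And>n. w n \<in> C1_c" "(\<lambda>n. Lp_norm q \<mu> (\<lambda>x. w n x - f x)) \<longlonglongrightarrow> 0"
      "(\<lambda>n. Lp_norm p \<mu> (\<lambda>x. directional_derivative v (w n) x - h x)) \<longlonglongrightarrow> 0"
    unfolding graph_closure_def by auto
  let ?\<tau> = "\<lambda>x. \<alpha> x *\<^sub>R v x"
  \<comment> \<open>The common limit \<open>f\<close> cancels in the difference, leaving a sequence
    whose derivatives along \<open>v\<close> approach \<open>g - h\<close>.\<close>
  define d where "d n x = u n x - w n x" for n x
  have d: "d n \<in> C1_c"
    and Dd: "frechet_derivative (d n) (at x) y = frechet_derivative (u n) (at x) y - frechet_derivative (w n) (at x) y" for n x y
    unfolding d_def using C1_c_diff[OF u(1) w(1)] by auto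
  have [measurable]: "f \<in> borel_measurable \<mu>" "g \<in> borel_measurable \<mu>" "h \<in> borel_measurable \<mu>"
      "\<alpha> \<in> borel_measurable \<mu>" "v \<in> borel_measurable \<mu>"
    using f g h \<alpha>(2) assms(7) by (auto simp: Lp_space_def)
  have C1_meas: "c \<in> borel_measurable borel" if "c \<in> C1_c" for c :: "real ^ 'n \<Rightarrow> real"
    by (intro borel_measurable_continuous_onI C1_c_continuous that)
  note [measurable] = C1_meas[OF u(1)] C1_meas[OF w(1)] C1_meas[OF d]
  have D_meas: "(\<lambda>x. directional_derivative v c x) \<in> borel_measurable \<mu>" if "c \<in> C1_c" for c
    unfolding directional_derivative_def by (rule C1_c_derivative_measurable[OF that sets]) measurable
  note [measurable] = D_meas[OF u(1)] D_meas[OF w(1)]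
  \<comment> \<open>Linearity pulls \<alpha> out of the direction, so convergence of the derivatives
    along \<open>v\<close> in Lp can be paired with \<alpha> in the dual exponent.\<close>
  have scale: "frechet_derivative c (at x) (?\<tau> x) = \<alpha> x * directional_derivative v c x" if "c \<in> C1_c" for c x
    unfolding directional_derivative_def
    using linear_scale[OF has_derivative_linear[OF C1_c_has_derivative[OF that]]] by simp
  have \<tau>: "integrable \<mu> ?\<tau>"
    using integrable_of_conjugate_Lp[OF assms(4) \<alpha>(2) assms(7)] .
  have "AE x in \<mu>. \<alpha> x * g x - \<alpha> x * h x = 0"
  proof (rule L1_closability)
    show "mass (boundary (vector_measure_current ?\<tau> \<mu>)) < \<infinity>"
      using \<alpha>(4) by (simp add: normal_1_current_def)
    show "integrable \<mu> (\<lambda>x. \<alpha> x * g x - \<alpha> x * h x)"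
      using integrable_of_conjugate_Lp[OF assms(4) \<alpha>(2) g] integrable_of_conjugate_Lp[OF assms(4) \<alpha>(2) h] by simp
    show "(\<lambda>n. \<integral>x. \<bar>d n x\<bar> * norm (?\<tau> x) \<partial>\<mu>) \<longlonglongrightarrow> 0"
    \<comment> \<open>Pairing of q and q': the errors of \<open>u\<close> and \<open>w\<close>
      against \<alpha> v.\<close>
    proof (rule tendsto_integral_zero_of_Lp_norm[OF assms(5) \<alpha>(3) _ _ u(2) w(2)])
      show "\<bar>d n x\<bar> * norm (?\<tau> x) \<le> (norm (u n x - f x) + norm (w n x - f x)) * norm (?\<tau> x)" for n x
        unfolding d_def by (intro mult_right_mono) auto
      show "(\<lambda>x. u n x - f x) \<in> borel_measurable \<mu>" "(\<lambda>x. w n x - f x) \<in> borel_measurable \<mu>"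
        "(\<lambda>x. \<bar>d n x\<bar> * norm (?\<tau> x)) \<in> borel_measurable \<mu>" for n
        by measurable
    qed simp
    show "(\<lambda>n. \<integral>x. \<bar>frechet_derivative (d n) (at x) (?\<tau> x) - (\<alpha> x * g x - \<alpha> x * h x)\<bar> \<partial>\<mu>) \<longlonglongrightarrow> 0"
      unfolding Dd scale[OF u(1)] scale[OF w(1)]
    \<comment> \<open>Pairing of p and p': the errors of the derivatives against \<alpha>.\<close>
    proof (rule tendsto_integral_zero_of_Lp_norm[OF assms(4) \<alpha>(2) _ _ u(3) w(3)])
      fix n x
      let ?a = "directional_derivative v (u n) x" and ?b = "directional_derivative v (w n) x"
      have "\<alpha> x * ?a - \<alpha> x * ?b - (\<alpha> x * g x - \<alpha> x * h x) = ((?a - g x) - (?b - h x)) * \<alpha> x"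
        by (simp add: algebra_simps)
      then have "\<bar>\<alpha> x * ?a - \<alpha> x * ?b - (\<alpha> x * g x - \<alpha> x * h x)\<bar> = \<bar>(?a - g x) - (?b - h x)\<bar> * norm (\<alpha> x)"
        by (simp only: abs_mult real_norm_def)
      also have "\<dots> \<le> (norm (?a - g x) + norm (?b - h x)) * norm (\<alpha> x)"
        by (intro mult_right_mono) auto
      finally show "\<bar>\<alpha> x * ?a - \<alpha> x * ?b - (\<alpha> x * g x - \<alpha> x * h x)\<bar> \<le> (norm (?a - g x) + norm (?b - h x)) * norm (\<alpha> x)" .
    next
      fix n
      show "(\<lambda>x. directional_derivative v (u n) x - g x) \<in> borel_measurable \<mu>"
        "(\<lambda>x. directional_derivative v (w n) x - h x) \<in> borel_measurable \<mu>"
        "(\<lambda>x. \<bar>\<alpha> x * directional_derivative v (u n) x - \<alpha> x * directional_derivative v (w n) x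
            - (\<alpha> x * g x - \<alpha> x * h x)\<bar>) \<in> borel_measurable \<mu>"
        by measurable
    qed simp
  qed (fact sets \<tau> d)+
  \<comment> \<open>As \<alpha> is nonzero almost everywhere, it can be divided out.\<close>
  with \<alpha>(1) show "AE x in \<mu>. g x = h x"
    by eventually_elim simp
qed

end
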